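(* Let $\Gamma$ be a set with $\mathrm{card}(\Gamma) = 2^{\aleph_0}$. There exists a $C^{\infty}$-smooth surjection $f: \ell_2(\Gamma) \to \mathbb{R}^2$ such that: (1) for every separable subspace $G$ of $\ell_2(\Gamma)$, the restriction $f|_G : G \to \mathbb{R}^2$ is not surjective; and (2) the set of critical values of $f$ has zero (Lebesgue) measure in $\mathbb{R}^2$.
   Context: $\ell_2(\Gamma)$ is the real Hilbert space of square-summable families indexed by $\Gamma$. $C^\infty$-smooth is meant in the Fréchet sense. Given a differentiable mapping $f: E \to F$ between Banach spaces, a point $x \in E$ is a critical point of $f$ if the differential $Df(x): E \to F$ is not surjective, and a point $y \in F$ is a critical value of $f$ if $f^{-1}(y)$ contains at least one critical point of $f$. *)

theory Defs
  imports "HOL-Analysis.Analysis"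
begin

typedef 'a ell2 = "{x :: 'a \<Rightarrow> real. (\<lambda>i. (x i)\<^sup>2) summable_on UNIV}"
  morphisms ell2_nth Abs_ell2
  by (rule exI[of _ "\<lambda>_. 0"]) simp

setup_lifting type_definition_ell2

lemma ell2_nth_summable: "(\<lambda>i. (ell2_nth x i)\<^sup>2) summable_on UNIV"
  using ell2_nth by blast

lemma square_summable_mult:
  fixes x y :: "'a \<Rightarrow> real"
  assumes "(\<lambda>i. (x i)\<^sup>2) summable_on UNIV" "(\<lambda>i. (y i)\<^sup>2) summable_on UNIV"
  shows "(\<lambda>i. x i * y i) summable_on UNIV"
proof -
  have "(\<lambda>i. (x i)\<^sup>2 + (y i)\<^sup>2) summable_on UNIV"
    using assms by (rule summable_on_add)
  moreover have "norm (x i * y i) \<le> (x i)\<^sup>2 + (y i)\<^sup>2" for i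
  proof -
    have "2 * (\<bar>x i\<bar> * \<bar>y i\<bar>) \<le> (x i)\<^sup>2 + (y i)\<^sup>2"
      using sum_squares_bound[of "\<bar>x i\<bar>" "\<bar>y i\<bar>"] by simp
    moreover have "0 \<le> \<bar>x i\<bar> * \<bar>y i\<bar>" by simp
    ultimately show ?thesis by (simp only: real_norm_def abs_mult)
  qed
  ultimately have "(\<lambda>i. norm (x i * y i)) summable_on UNIV"
    using Infinite_Sum.abs_summable_on_comparison_test'[of "\<lambda>i. (x i)\<^sup>2 + (y i)\<^sup>2" UNIV "\<lambda>i. x i * y i"]
    by blast
  then show ?thesis by (rule abs_summable_summable)
qed

lemma square_summable_add:
  fixes x y :: "'a \<Rightarrow> real"
  assumes "(\<lambda>i. (x i)\<^sup>2) summable_on UNIV" "(\<lambda>i. (y i)\<^sup>2) summable_on UNIV"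
  shows "(\<lambda>i. (x i + y i)\<^sup>2) summable_on UNIV"
proof -
  have "(\<lambda>i. ((x i)\<^sup>2 + (y i)\<^sup>2) + 2 * (x i * y i)) summable_on UNIV"
    by (intro summable_on_add summable_on_cmult_right square_summable_mult assms)
  then show ?thesis by (simp add: power2_sum mult.assoc)
qed

lemma square_summable_scale:
  fixes x :: "'a \<Rightarrow> real"
  assumes "(\<lambda>i. (x i)\<^sup>2) summable_on UNIV"
  shows "(\<lambda>i. (c * x i)\<^sup>2) summable_on UNIV"
  using summable_on_cmult_right[OF assms, of "c\<^sup>2"] by (simp add: power_mult_distrib)

instantiation ell2 :: (type) real_inner
begin

lift_definition zero_ell2 :: "'a ell2" is "\<lambda>_. 0" by simp

lift_definition plus_ell2 :: "'a ell2 \<Rightarrow> 'a ell2 \<Rightarrow> 'a ell2" is "\<lambda>x y i. x i + y i"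
  by (rule square_summable_add)

lift_definition uminus_ell2 :: "'a ell2 \<Rightarrow> 'a ell2" is "\<lambda>x i. - x i" by simp

lift_definition minus_ell2 :: "'a ell2 \<Rightarrow> 'a ell2 \<Rightarrow> 'a ell2" is "\<lambda>x y i. x i - y i"
  subgoal for x y using square_summable_add[of x "\<lambda>i. - y i"] by simp
  done

lift_definition scaleR_ell2 :: "real \<Rightarrow> 'a ell2 \<Rightarrow> 'a ell2" is "\<lambda>c x i. c * x i"
  by (rule square_summable_scale)

definition inner_ell2 :: "'a ell2 \<Rightarrow> 'a ell2 \<Rightarrow> real" where
  "inner_ell2 x y = (\<Sum>\<^sub>\<infinity>i. ell2_nth x i * ell2_nth y i)"

definition norm_ell2 :: "'a ell2 \<Rightarrow> real" where
  "norm_ell2 x = sqrt (inner x x)"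

definition dist_ell2 :: "'a ell2 \<Rightarrow> 'a ell2 \<Rightarrow> real" where
  "dist_ell2 x y = norm (x - y)"

definition sgn_ell2 :: "'a ell2 \<Rightarrow> 'a ell2" where
  "sgn_ell2 x = inverse (norm x) *\<^sub>R x"

definition uniformity_ell2 :: "('a ell2 \<times> 'a ell2) filter" where
  "uniformity_ell2 = (INF e\<in>{0 <..}. principal {(x, y). dist x y < e})"

definition open_ell2 :: "'a ell2 set \<Rightarrow> bool" where
  "open_ell2 U \<longleftrightarrow> (\<forall>x\<in>U. \<forall>\<^sub>F (x', y) in uniformity. x' = x \<longrightarrow> y \<in> U)"

instance
proof
  fix x y z :: "'a ell2" and r s :: real
  have summ: "(\<lambda>i. ell2_nth u i * ell2_nth v i) summable_on UNIV" for u v :: "'a ell2"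
    by (intro square_summable_mult ell2_nth_summable)
  show "x + y + z = x + (y + z)" by transfer (simp add: add.assoc)
  show "x + y = y + x" by transfer (simp add: add.commute)
  show "0 + x = x" by transfer simp
  show "- x + x = 0" by transfer simp
  show "x - y = x + - y" by transfer simp
  show "r *\<^sub>R (x + y) = r *\<^sub>R x + r *\<^sub>R y" by transfer (simp add: distrib_left)
  show "(r + s) *\<^sub>R x = r *\<^sub>R x + s *\<^sub>R x" by transfer (simp add: distrib_right)
  show "r *\<^sub>R s *\<^sub>R x = (r * s) *\<^sub>R x" by transfer (simp add: mult.assoc)
  show "1 *\<^sub>R x = x" by transfer simp
  show "dist x y = norm (x - y)" by (rule dist_ell2_def)
  show "sgn x = inverse (norm x) *\<^sub>R x" by (rule sgn_ell2_def)
  show "uniformity = (INF e\<in>{0 <..}. principal {(x, y :: 'a ell2). dist x y < e})"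
    by (rule uniformity_ell2_def)
  show "open U \<longleftrightarrow> (\<forall>x\<in>U. \<forall>\<^sub>F (x', y) in uniformity. x' = x \<longrightarrow> y \<in> U)"
    for U :: "'a ell2 set" by (rule open_ell2_def)
  show "inner x y = inner y x" by (simp add: inner_ell2_def mult.commute)
  show "inner (x + y) z = inner x z + inner y z"
    unfolding inner_ell2_def
    by (subst infsum_add[symmetric]) (auto intro: summ simp: plus_ell2.rep_eq distrib_right)
  show "inner (r *\<^sub>R x) y = r * inner x y"
    by (simp add: inner_ell2_def scaleR_ell2.rep_eq mult.assoc infsum_cmult_right')
  show "0 \<le> inner x x"
    unfolding inner_ell2_def by (rule infsum_nonneg) simp
  show "inner x x = 0 \<longleftrightarrow> x = 0"
  proof
    assume "inner x x = 0"
    then have "ell2_nth x i * ell2_nth x i = 0" for i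
      by (intro nonneg_infsum_le_0D[where A = UNIV]) (auto simp: inner_ell2_def intro: summ)
    then show "x = 0" by transfer auto
  qed (simp add: inner_ell2_def zero_ell2.rep_eq)
  show "norm x = sqrt (inner x x)" by (rule norm_ell2_def)
qed

end

lemma norm_ell2_eq: "norm x = sqrt (\<Sum>\<^sub>\<infinity>i. (ell2_nth x i)\<^sup>2)"
  by (simp add: norm_ell2_def inner_ell2_def power2_eq_square)

lemma sum_le_norm_ell2:
  assumes "finite F"
  shows "(\<Sum>i\<in>F. (ell2_nth x i)\<^sup>2) \<le> (norm x)\<^sup>2"
proof -
  have "(\<Sum>i\<in>F. (ell2_nth x i)\<^sup>2) \<le> (\<Sum>\<^sub>\<infinity>i. (ell2_nth x i)\<^sup>2)"
    by (rule finite_sum_le_infsum) (auto simp: assms ell2_nth_summable)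
  also have "\<dots> = (norm x)\<^sup>2"
    by (simp add: norm_ell2_eq infsum_nonneg)
  finally show ?thesis .
qed

lemma abs_ell2_nth_le_norm: "\<bar>ell2_nth x i\<bar> \<le> norm x"
  using sum_le_norm_ell2[of "{i}" x] by (simp add: abs_le_square_iff[symmetric])

instance ell2 :: (type) complete_space
proof
  fix X :: "nat \<Rightarrow> 'a ell2"
  assume X: "Cauchy X"
  have "Cauchy (\<lambda>n. ell2_nth (X n) i)" for i
  proof (rule metric_CauchyI)
    fix e :: real assume "0 < e"
    then obtain M where M: "\<And>m n. m \<ge> M \<Longrightarrow> n \<ge> M \<Longrightarrow> dist (X m) (X n) < e"
      using metric_CauchyD[OF X] by blast
    have "dist (ell2_nth (X m) i) (ell2_nth (X n) i) < e" if "m \<ge> M" "n \<ge> M" for m n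
      using abs_ell2_nth_le_norm[of "X m - X n" i] M[OF that]
      by (simp add: dist_norm minus_ell2.rep_eq)
    then show "\<exists>M. \<forall>m\<ge>M. \<forall>n\<ge>M. dist (ell2_nth (X m) i) (ell2_nth (X n) i) < e" by blast
  qed
  then have "\<forall>i. \<exists>l. (\<lambda>n. ell2_nth (X n) i) \<longlonglongrightarrow> l"
    by (simp add: Cauchy_convergent_iff convergent_def)
  then obtain l where l: "\<And>i. (\<lambda>n. ell2_nth (X n) i) \<longlonglongrightarrow> l i" by metis
  have bound: "\<exists>M. \<forall>n\<ge>M. \<forall>F. finite F \<longrightarrow> (\<Sum>i\<in>F. (ell2_nth (X n) i - l i)\<^sup>2) \<le> e\<^sup>2"
    if "0 < e" for e
  proof -
    obtain M where M: "\<And>m n. m \<ge> M \<Longrightarrow> n \<ge> M \<Longrightarrow> dist (X m) (X n) < e"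
      using metric_CauchyD[OF X \<open>0 < e\<close>] by blast
    have "(\<Sum>i\<in>F. (ell2_nth (X n) i - l i)\<^sup>2) \<le> e\<^sup>2" if "n \<ge> M" "finite F" for n F
    proof (rule LIMSEQ_le_const2)
      show "(\<lambda>m. \<Sum>i\<in>F. (ell2_nth (X n) i - ell2_nth (X m) i)\<^sup>2)
          \<longlonglongrightarrow> (\<Sum>i\<in>F. (ell2_nth (X n) i - l i)\<^sup>2)"
        by (intro tendsto_intros l)
      have "(\<Sum>i\<in>F. (ell2_nth (X n) i - ell2_nth (X m) i)\<^sup>2) \<le> e\<^sup>2" if "m \<ge> M" for m
      proof -
        have "(\<Sum>i\<in>F. (ell2_nth (X n) i - ell2_nth (X m) i)\<^sup>2) \<le> (norm (X n - X m))\<^sup>2"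
          using sum_le_norm_ell2[OF \<open>finite F\<close>, of "X n - X m"] by (simp add: minus_ell2.rep_eq)
        also have "\<dots> \<le> e\<^sup>2"
          using M[OF \<open>n \<ge> M\<close> \<open>m \<ge> M\<close>] by (intro power_mono) (auto simp: dist_norm)
        finally show ?thesis .
      qed
      then show "\<exists>N. \<forall>m\<ge>N. (\<Sum>i\<in>F. (ell2_nth (X n) i - ell2_nth (X m) i)\<^sup>2) \<le> e\<^sup>2" by blast
    qed
    then show ?thesis by blast
  qed
  have diff: "(\<lambda>i. (ell2_nth (X n) i - l i)\<^sup>2) summable_on UNIV"
    if "\<forall>F. finite F \<longrightarrow> (\<Sum>i\<in>F. (ell2_nth (X n) i - l i)\<^sup>2) \<le> C" for n C
    by (rule nonneg_bdd_above_summable_on) (use that in \<open>auto intro!: bdd_aboveI\<close>)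
  obtain M where
    M: "\<And>n F. n \<ge> M \<Longrightarrow> finite F \<Longrightarrow> (\<Sum>i\<in>F. (ell2_nth (X n) i - l i)\<^sup>2) \<le> 1\<^sup>2"
    using bound[of 1] by auto
  have "(\<lambda>i. (ell2_nth (X M) i + - (ell2_nth (X M) i - l i))\<^sup>2) summable_on UNIV"
  proof (rule square_summable_add)
    show "(\<lambda>i. (- (ell2_nth (X M) i - l i))\<^sup>2) summable_on UNIV"
      unfolding power2_minus by (rule diff[of M "1\<^sup>2"]) (use M[of M] in blast)
  qed (rule ell2_nth_summable)
  then obtain L where L: "ell2_nth L = l"
    using Abs_ell2_inverse[of l] by auto
  have "X \<longlonglongrightarrow> L"
  proof (rule metric_LIMSEQ_I)
    fix r :: real assume "0 < r"
    then obtain N where N: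
      "\<And>n F. n \<ge> N \<Longrightarrow> finite F \<Longrightarrow> (\<Sum>i\<in>F. (ell2_nth (X n) i - l i)\<^sup>2) \<le> (r / 2)\<^sup>2"
      using bound[of "r / 2"] by auto
    have "dist (X n) L < r" if "n \<ge> N" for n
    proof -
      have "(\<Sum>\<^sub>\<infinity>i. (ell2_nth (X n - L) i)\<^sup>2) \<le> (r / 2)\<^sup>2"
        using N[OF that] L
        by (intro infsum_le_finite_sums ell2_nth_summable) (simp add: minus_ell2.rep_eq)
      then have "norm (X n - L) \<le> r / 2"
        unfolding norm_ell2_eq using \<open>0 < r\<close> by (intro real_le_lsqrt) (auto intro: infsum_nonneg)
      then show ?thesis using \<open>0 < r\<close> by (simp add: dist_norm)
    qed
    then show "\<exists>no. \<forall>n\<ge>no. dist (X n) L < r" by blast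
  qed
  then show "convergent X" by (auto simp: convergent_def)
qed

text \<open>
  The spaces \<open>L(E, L(E, \<dots>, L(E, F)))\<close> in which the iterated Frechet derivatives live
  have different types for different orders. They are identified, as usual, with the spaces
  \<open>L\<^sup>k(E; F)\<close> of bounded \<open>k\<close>-linear maps under the operator norm. A \<open>k\<close>-linear map is
  represented by a function on argument lists; only lists of length \<open>k\<close> are relevant.
\<close>

definition bounded_multilinear ::
    "nat \<Rightarrow> ('a::real_normed_vector list \<Rightarrow> 'b::real_normed_vector) \<Rightarrow> bool" where
  "bounded_multilinear k T \<longleftrightarrow>
     (\<forall>us ws. length us + 1 + length ws = k \<longrightarrow> linear (\<lambda>v. T (us @ v # ws))) \<and>
     (\<exists>K. \<forall>vs. length vs = k \<longrightarrow> norm (T vs) \<le> K * prod_list (map norm vs))"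

text \<open>
  In the next definition \<open>D k x\<close> is the \<open>k\<close>-th derivative of \<open>f\<close> at \<open>x\<close>. The last conjunct says
  that \<open>D k\<close>, as a map into \<open>L\<^sup>k(E; F)\<close>, is Frechet differentiable at \<open>x\<close> with derivative
  \<open>h \<mapsto> D (k + 1) x (h, \<dots>)\<close>: the operator norm of the remainder is at most
  \<open>e * norm (y - x)\<close> for \<open>y\<close> near \<open>x\<close>.
\<close>

definition frechet_derivatives ::
    "('a::real_normed_vector \<Rightarrow> 'b::real_normed_vector) \<Rightarrow> (nat \<Rightarrow> 'a \<Rightarrow> 'a list \<Rightarrow> 'b) \<Rightarrow> bool" where
  "frechet_derivatives f D \<longleftrightarrow>
     (\<forall>x. D 0 x [] = f x) \<and>
     (\<forall>k x. bounded_multilinear k (D k x)) \<and>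
     (\<forall>k x. \<forall>e>0. \<forall>\<^sub>F y in nhds x. \<forall>vs. length vs = k \<longrightarrow>
        norm (D k y vs - D k x vs - D (Suc k) x ((y - x) # vs))
          \<le> e * norm (y - x) * prod_list (map norm vs))"

definition smooth :: "('a::real_normed_vector \<Rightarrow> 'b::real_normed_vector) \<Rightarrow> bool" where
  "smooth f \<longleftrightarrow> (\<exists>D. frechet_derivatives f D)"

lemma frechet_derivatives_has_derivative:
  assumes "frechet_derivatives f D"
  shows "(f has_derivative (\<lambda>h. D 1 x [h])) (at x)"
proof -
  have D0: "D 0 y [] = f y" for y
    using assms by (simp add: frechet_derivatives_def)
  have D1: "bounded_multilinear 1 (D 1 x)"
    using assms unfolding frechet_derivatives_def by blast
  have "linear (\<lambda>v. D 1 x ([] @ v # []))"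
    using D1 unfolding bounded_multilinear_def by (metis add_0 add_0_right list.size(3))
  then have lin: "linear (\<lambda>v. D 1 x [v])" by simp
  obtain K where K: "\<And>vs. length vs = 1 \<Longrightarrow> norm (D 1 x vs) \<le> K * prod_list (map norm vs)"
    using D1 unfolding bounded_multilinear_def by blast
  have "bounded_linear (\<lambda>h. D 1 x [h])"
  proof (rule bounded_linear_intro)
    show "D 1 x [v + w] = D 1 x [v] + D 1 x [w]" for v w
      using linear_add[OF lin] .
    show "D 1 x [r *\<^sub>R v] = r *\<^sub>R D 1 x [v]" for r v
      using linear_cmul[OF lin] .
    show "norm (D 1 x [v]) \<le> norm v * K" for v
      using K[of "[v]"] by (simp add: mult.commute)
  qed
  moreover have "\<exists>d>0. \<forall>y. norm (y - x) < d \<longrightarrow> norm (f y - f x - D 1 x [y - x]) \<le> e * norm (y - x)"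
    if "0 < e" for e
  proof -
    have "\<forall>\<^sub>F y in nhds x. \<forall>vs. length vs = 0 \<longrightarrow>
        norm (D 0 y vs - D 0 x vs - D (Suc 0) x ((y - x) # vs))
          \<le> e * norm (y - x) * prod_list (map norm vs)"
      using assms that unfolding frechet_derivatives_def by blast
    then show ?thesis by (simp add: D0 eventually_nhds_metric dist_norm)
  qed
  ultimately show ?thesis by (simp add: has_derivative_within_alt)
qed

corollary smooth_imp_differentiable: "smooth f \<Longrightarrow> f differentiable (at x)"
  using frechet_derivatives_has_derivative by (auto simp: smooth_def differentiable_def)

definition critical_point :: "('a::real_normed_vector \<Rightarrow> 'b::real_normed_vector) \<Rightarrow> 'a \<Rightarrow> bool" where
  "critical_point f x \<longleftrightarrow> \<not> surj (frechet_derivative f (at x))"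

definition critical_values :: "('a::real_normed_vector \<Rightarrow> 'b::real_normed_vector) \<Rightarrow> 'b set" where
  "critical_values f = {y. \<exists>x \<in> f -` {y}. critical_point f x}"

end

theory Submission
  imports Defs
begin

text \<open>
  Call one index \<open>base\<close> and write \<open>u\<close> for the coordinate of \<open>x\<close> at \<open>base\<close>. Label the other
  indices by real numbers so that every real occurs as a label. Let \<open>K\<close> be a Cantor set: closed,
  uncountable, Lebesgue null, and symmetric about \<open>0\<close>. The map is a polynomial in the coordinates of
  \<open>x\<close>. It sends \<open>x\<close> to the complex square \<open>(w + i u)\<^sup>2\<close>, where
  \<open>w = (q - 1)\<^sup>2 + (\<Sum>i. b u (lab i) * (x i)\<^sup>2)\<close>, \<open>q = (\<Sum>(x i)\<^sup>2)\<close> over the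
  indices with label in \<open>K\<close>, both sums omit \<open>base\<close>, and
  \<open>b u t = ((u - t)\<^sup>2 - dist(t, K)\<^sup>2) / (1 + t\<^sup>2)\<close>.

  \<^item> \<^emph>\<open>Separable subspaces.\<close> If \<open>u\<close> lies in \<open>K\<close>, no \<open>b u t\<close> is negative, so \<open>w \<ge> 0\<close>; and
    \<open>w = 0\<close> forces \<open>q = 1\<close> together with \<open>b u (lab i) = 0\<close> wherever \<open>x i \<noteq> 0\<close>, so that some
    coordinate with label exactly \<open>u\<close> is nonzero (\<open>height_zero\<close>). The elements of a separable
    subspace are supported in one countable index set, which carries only countably many labels. Hence
    some \<open>k\<close> in \<open>K\<close> gives a value \<open>(i k)\<^sup>2\<close> that is not taken on the subspace. This value has the
    second square root \<open>- i k\<close>, and the argument applies to it because \<open>- k\<close> lies in \<open>K\<close> too.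

  \<^item> \<^emph>\<open>Surjectivity.\<close> If \<open>u\<close> lies in \<open>K\<close>, the coordinate labelled \<open>u\<close> produces all \<open>w \<ge> 0\<close>. If
    \<open>u\<close> lies outside \<open>K\<close>, then \<open>b u u < 0\<close>, and the coordinate labelled \<open>u\<close> produces all
    \<open>w \<le> 0\<close>. For each \<open>(u, w)\<close>, either it or \<open>(- u, - w)\<close> is of one of these kinds, and both
    have the same square. Squaring is what makes surjectivity possible: for fixed \<open>u\<close> in \<open>K\<close> the
    function \<open>w\<close> omits the negative numbers.

  \<^item> \<^emph>\<open>Critical values.\<close> The coordinate \<open>u\<close> has derivative \<open>1\<close> along \<open>base\<close>, and squaring is a
    local diffeomorphism away from \<open>0\<close>. So at a critical point with nonzero value all partial
    derivatives of \<open>w\<close> along the other coordinates vanish, and this gives \<open>w = 1 - q\<^sup>2\<close> with either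
    \<open>q = 0\<close> or \<open>q = 1 - (u - t)\<^sup>2 / (2 (1 + t\<^sup>2))\<close> for some \<open>t\<close> in \<open>K\<close> (\<open>critical_height\<close>). The
    critical values thus lie in differentiable images of the plane null sets \<open>\<real> \<times> {0}\<close> and
    \<open>\<real> \<times> K\<close>, together with the origin.

  Smoothness follows from the closure of smooth maps under sums and bounded bilinear products.
\<close>

section \<open>Closure properties of smooth maps\<close>

lemma prod_list_norm_nonneg: "0 \<le> prod_list (map norm vs)"
  by (induction vs) auto

text \<open>
  A jet gathers the derivatives of all orders at a point into one function of an argument list, the
  length of the list being the order. Without a separate order index, the product rule below becomes
  a recursion on lists.
\<close>

definition smooth_jet ::
    "('a::real_normed_vector \<Rightarrow> 'b::real_normed_vector) \<Rightarrow> ('a \<Rightarrow> 'a list \<Rightarrow> 'b) \<Rightarrow> bool" where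
  "smooth_jet f J \<longleftrightarrow>
     (\<forall>x. J x [] = f x) \<and>
     (\<forall>x us ws. linear (\<lambda>v. J x (us @ v # ws))) \<and>
     (\<forall>k x. \<exists>K. \<forall>vs. length vs = k \<longrightarrow> norm (J x vs) \<le> K * prod_list (map norm vs)) \<and>
     (\<forall>k x. \<forall>e>0. \<forall>\<^sub>F y in nhds x. \<forall>vs. length vs = k \<longrightarrow>
        norm (J y vs - J x vs - J x ((y - x) # vs))
          \<le> e * norm (y - x) * prod_list (map norm vs))"

lemma smooth_jetI:
  assumes "\<And>x. J x [] = f x"
    and "\<And>x us ws. linear (\<lambda>v. J x (us @ v # ws))"
    and "\<And>k x. \<exists>K. \<forall>vs. length vs = k \<longrightarrow> norm (J x vs) \<le> K * prod_list (map norm vs)"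
    and "\<And>k x e. 0 < e \<Longrightarrow> \<forall>\<^sub>F y in nhds x. \<forall>vs. length vs = k \<longrightarrow>
        norm (J y vs - J x vs - J x ((y - x) # vs)) \<le> e * norm (y - x) * prod_list (map norm vs)"
  shows "smooth_jet f J"
  using assms unfolding smooth_jet_def by blast

lemma smooth_jetD:
  assumes "smooth_jet f J"
  shows "J x [] = f x"
    and "linear (\<lambda>v. J x (us @ v # ws))"
    and "\<exists>K. \<forall>vs. length vs = k \<longrightarrow> norm (J x vs) \<le> K * prod_list (map norm vs)"
    and "0 < e \<Longrightarrow> \<forall>\<^sub>F y in nhds x. \<forall>vs. length vs = k \<longrightarrow>
        norm (J y vs - J x vs - J x ((y - x) # vs)) \<le> e * norm (y - x) * prod_list (map norm vs)"
  using assms unfolding smooth_jet_def by blast+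

lemma smooth_iff_jet: "smooth f \<longleftrightarrow> (\<exists>J. smooth_jet f J)"
proof
  assume "smooth f"
  then obtain D where "frechet_derivatives f D" by (auto simp: smooth_def)
  then have "\<And>x. D 0 x [] = f x" and B: "\<And>k x. bounded_multilinear k (D k x)"
    and R: "\<And>k x e. 0 < e \<Longrightarrow> \<forall>\<^sub>F y in nhds x. \<forall>vs. length vs = k \<longrightarrow>
        norm (D k y vs - D k x vs - D (Suc k) x ((y - x) # vs))
          \<le> e * norm (y - x) * prod_list (map norm vs)"
    unfolding frechet_derivatives_def by blast+
  moreover have "linear (\<lambda>v. D (length (us @ v # ws)) x (us @ v # ws))" for x us ws
    using B[of "length us + 1 + length ws" x] unfolding bounded_multilinear_def by simp
  moreover have "\<exists>K. \<forall>vs. length vs = k \<longrightarrow> norm (D (length vs) x vs) \<le> K * prod_list (map norm vs)"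
    for k x
    using B[of k x] unfolding bounded_multilinear_def by auto
  moreover have "\<forall>\<^sub>F y in nhds x. \<forall>vs. length vs = k \<longrightarrow>
        norm (D (length vs) y vs - D (length vs) x vs - D (length ((y - x) # vs)) x ((y - x) # vs))
          \<le> e * norm (y - x) * prod_list (map norm vs)" if "0 < e" for k x e
    using R[OF that, of k x] by eventually_elim auto
  ultimately have "smooth_jet f (\<lambda>x vs. D (length vs) x vs)"
    by (intro smooth_jetI) auto
  then show "\<exists>J. smooth_jet f J" by blast
next
  assume "\<exists>J. smooth_jet f J"
  then obtain J where "smooth_jet f J" ..
  then have "frechet_derivatives f (\<lambda>_. J)"
    unfolding frechet_derivatives_def smooth_jet_def bounded_multilinear_def by blast
  then show "smooth f" by (auto simp: smooth_def)
qed

text \<open>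
  The iterated product rule: each direction in the list differentiates either the left or the right
  factor. Putting the direction at the head of the list passed to \<open>F\<close> or \<open>G\<close> is the rule by which
  a jet is differentiated, so \<open>leibniz B F G (h # vs)\<close> is already the candidate for the derivative of
  \<open>leibniz B F G vs\<close> in the direction \<open>h\<close>.
\<close>

fun leibniz ::
    "('b \<Rightarrow> 'c \<Rightarrow> 'd::ab_group_add) \<Rightarrow> ('a list \<Rightarrow> 'b) \<Rightarrow> ('a list \<Rightarrow> 'c) \<Rightarrow> 'a list \<Rightarrow> 'd" where
  "leibniz B F G [] = B (F []) (G [])"
| "leibniz B F G (v # vs) = leibniz B (\<lambda>l. F (v # l)) G vs + leibniz B F (\<lambda>l. G (v # l)) vs"

context bounded_bilinear begin

lemma leibniz_linear_left:
  assumes "\<And>l. linear (\<lambda>v. F v l)"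
  shows "linear (\<lambda>v. leibniz prod (F v) G vs)"
  using assms
proof (induction vs arbitrary: F G)
  case Nil
  from linear_compose[OF Nil[of "[]"], of "\<lambda>a. prod a (G [])"] show ?case
    by (simp add: o_def bounded_linear_left bounded_linear.linear)
qed (simp add: linear_compose_add)

lemma leibniz_linear_right:
  assumes "\<And>l. linear (\<lambda>v. G v l)"
  shows "linear (\<lambda>v. leibniz prod F (G v) vs)"
  using assms
proof (induction vs arbitrary: F G)
  case Nil
  from linear_compose[OF Nil[of "[]"], of "prod (F [])"] show ?case
    by (simp add: o_def bounded_linear_right bounded_linear.linear)
qed (simp add: linear_compose_add)

lemma leibniz_multilinear:
  assumes "\<And>us ws. linear (\<lambda>v. F (us @ v # ws))" "\<And>us ws. linear (\<lambda>v. G (us @ v # ws))"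
  shows "linear (\<lambda>v. leibniz prod F G (us @ v # ws))"
  using assms
proof (induction us arbitrary: F G)
  case Nil
  have "linear (\<lambda>v. F (v # l))" "linear (\<lambda>v. G (v # l))" for l
    using Nil(1)[of "[]"] Nil(2)[of "[]"] by simp_all
  then show ?case
    by (simp add: linear_compose_add leibniz_linear_left leibniz_linear_right)
next
  case (Cons u us)
  have "linear (\<lambda>v. F (u # us @ v # ws))" "linear (\<lambda>v. G (u # us @ v # ws))" for us ws
    using Cons.prems(1)[of "u # us"] Cons.prems(2)[of "u # us"] by simp_all
  then show ?case
    by (simp add: linear_compose_add Cons.IH Cons.prems)
qed

lemma leibniz_diff_left:
  "leibniz prod (\<lambda>l. F l - F' l) G vs = leibniz prod F G vs - leibniz prod F' G vs"
  by (induction vs arbitrary: F F' G) (simp_all add: diff_left)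

lemma leibniz_diff_right:
  "leibniz prod F (\<lambda>l. G l - G' l) vs = leibniz prod F G vs - leibniz prod F G' vs"
  by (induction vs arbitrary: F G G') (simp_all add: diff_right)

text \<open>
  The recursion doubles the number of products at each step, and each product carries the norm of
  every direction exactly once. This gives the factor \<open>2 ^ length vs\<close>.
\<close>

lemma norm_leibniz_le:
  assumes K: "\<And>a b. norm (prod a b) \<le> norm a * norm b * K" "0 \<le> K"
    and "\<And>l. length l \<le> length vs \<Longrightarrow> norm (F l) \<le> a * prod_list (map norm l)"
    and "\<And>l. length l \<le> length vs \<Longrightarrow> norm (G l) \<le> b * prod_list (map norm l)"
    and "0 \<le> a" "0 \<le> b"
  shows "norm (leibniz prod F G vs) \<le> 2 ^ length vs * (a * b * K) * prod_list (map norm vs)"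
  using assms(3-)
proof (induction vs arbitrary: F G a b)
  case Nil
  have "norm (prod (F []) (G [])) \<le> norm (F []) * norm (G []) * K" by (rule K)
  also have "\<dots> \<le> a * b * K"
    using Nil(1)[of "[]"] Nil(2)[of "[]"] K(2) Nil(3,4) by (intro mult_mono mult_nonneg_nonneg) auto
  finally show ?case by simp
next
  case (Cons v vs)
  have F': "norm (F (v # l)) \<le> (a * norm v) * prod_list (map norm l)" if "length l \<le> length vs" for l
    using Cons.prems(1)[of "v # l"] that by (simp add: mult.assoc)
  have G': "norm (G (v # l)) \<le> (b * norm v) * prod_list (map norm l)" if "length l \<le> length vs" for l
    using Cons.prems(2)[of "v # l"] that by (simp add: mult.assoc)
  have "norm (leibniz prod (\<lambda>l. F (v # l)) G vs)
      \<le> 2 ^ length vs * ((a * norm v) * b * K) * prod_list (map norm vs)"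
    using Cons.prems F' G' by (intro Cons.IH) auto
  moreover have "norm (leibniz prod F (\<lambda>l. G (v # l)) vs)
      \<le> 2 ^ length vs * (a * (b * norm v) * K) * prod_list (map norm vs)"
    using Cons.prems F' G' by (intro Cons.IH) auto
  ultimately have "norm (leibniz prod F G (v # vs))
      \<le> 2 ^ length vs * ((a * norm v) * b * K) * prod_list (map norm vs)
        + 2 ^ length vs * (a * (b * norm v) * K) * prod_list (map norm vs)"
    unfolding leibniz.simps by (rule norm_triangle_mono)
  then show ?case by (simp add: algebra_simps)
qed

text \<open>
  The familiar splitting from the proof of the product rule, lifted to all orders at once: in the
  first and third terms a Taylor remainder of one factor appears, in the second a first derivative is
  multiplied by an increment. Each term is therefore small of higher order in \<open>h\<close>, by
  \<open>norm_leibniz_le\<close>.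
\<close>

lemma leibniz_remainder:
  "leibniz prod Fy Gy vs - leibniz prod F G vs - leibniz prod F G (h # vs) =
     leibniz prod (\<lambda>l. Fy l - F l - F (h # l)) Gy vs
     + leibniz prod (\<lambda>l. F (h # l)) (\<lambda>l. Gy l - G l) vs
     + leibniz prod F (\<lambda>l. Gy l - G l - G (h # l)) vs"
  by (simp add: leibniz_diff_left leibniz_diff_right)

end

text \<open>
  The product rule at order \<open>k\<close> involves the factors at all orders up to \<open>k\<close>. The next two lemmas
  make the bounds of a jet uniform over these finitely many orders.
\<close>

lemma smooth_jet_bound_le:
  assumes "smooth_jet f J"
  obtains K where "0 \<le> K"
    "\<And>vs. length vs \<le> k \<Longrightarrow> norm (J x vs) \<le> K * prod_list (map norm vs)"
proof -
  from assms have "\<forall>j. \<exists>K. \<forall>vs. length vs = j \<longrightarrow> norm (J x vs) \<le> K * prod_list (map norm vs)"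
    unfolding smooth_jet_def by blast
  then obtain K where K: "\<And>j vs. length vs = j \<Longrightarrow> norm (J x vs) \<le> K j * prod_list (map norm vs)"
    by metis
  show ?thesis
  proof
    show "0 \<le> (\<Sum>j\<le>k. \<bar>K j\<bar>)" by (simp add: sum_nonneg)
    show "norm (J x vs) \<le> (\<Sum>j\<le>k. \<bar>K j\<bar>) * prod_list (map norm vs)" if "length vs \<le> k" for vs
    proof -
      have "K (length vs) \<le> (\<Sum>j\<le>k. \<bar>K j\<bar>)"
        using member_le_sum[of "length vs" "{..k}" "\<lambda>j. \<bar>K j\<bar>"] that by simp
      then show ?thesis
        using K[OF refl, of vs] mult_right_mono[OF _ prod_list_norm_nonneg[of vs]] order_trans by blast
    qed
  qed
qed

lemma smooth_jet_remainder_le: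
  assumes "smooth_jet f J" "0 < e"
  shows "\<forall>\<^sub>F y in nhds x. \<forall>vs. length vs \<le> k \<longrightarrow>
      norm (J y vs - J x vs - J x ((y - x) # vs)) \<le> e * norm (y - x) * prod_list (map norm vs)"
proof -
  from assms have "\<forall>j. \<forall>\<^sub>F y in nhds x. \<forall>vs. length vs = j \<longrightarrow>
      norm (J y vs - J x vs - J x ((y - x) # vs)) \<le> e * norm (y - x) * prod_list (map norm vs)"
    unfolding smooth_jet_def by blast
  then have "\<forall>\<^sub>F y in nhds x. \<forall>j\<in>{..k}. \<forall>vs. length vs = j \<longrightarrow>
      norm (J y vs - J x vs - J x ((y - x) # vs)) \<le> e * norm (y - x) * prod_list (map norm vs)"
    by (intro eventually_ball_finite) auto
  then show ?thesis by eventually_elim auto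
qed

lemma (in bounded_bilinear) smooth_prod:
  fixes f :: "'e::real_normed_vector \<Rightarrow> 'a" and g :: "'e \<Rightarrow> 'b"
  assumes "smooth f" "smooth g"
  shows "smooth (\<lambda>x. prod (f x) (g x))"
proof -
  from assms obtain J L where J: "smooth_jet f J" and L: "smooth_jet g L"
    by (auto simp: smooth_iff_jet)
  obtain K where K: "0 \<le> K" "\<And>a b. norm (prod a b) \<le> norm a * norm b * K"
    using nonneg_bounded by blast
  note bd = norm_leibniz_le[OF K(2,1)]
  have "smooth_jet (\<lambda>x. prod (f x) (g x)) (\<lambda>x. leibniz prod (J x) (L x))"
  proof (rule smooth_jetI)
    show "leibniz prod (J x) (L x) [] = prod (f x) (g x)" for x
      using J L by (simp add: smooth_jet_def)
    show "linear (\<lambda>v. leibniz prod (J x) (L x) (us @ v # ws))" for x us ws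
      by (rule leibniz_multilinear) (rule smooth_jetD(2)[OF J] smooth_jetD(2)[OF L])+
    show "\<exists>C. \<forall>vs. length vs = k \<longrightarrow>
        norm (leibniz prod (J x) (L x) vs) \<le> C * prod_list (map norm vs)" for k x
    proof -
      obtain a where a: "0 \<le> a" "\<And>vs. length vs \<le> k \<Longrightarrow> norm (J x vs) \<le> a * prod_list (map norm vs)"
        using smooth_jet_bound_le[OF J] by blast
      obtain b where b: "0 \<le> b" "\<And>vs. length vs \<le> k \<Longrightarrow> norm (L x vs) \<le> b * prod_list (map norm vs)"
        using smooth_jet_bound_le[OF L] by blast
      show ?thesis
        by (rule exI[of _ "2 ^ k * (a * b * K)"]) (use bd[OF _ _ a(1) b(1)] a b in auto)
    qed
    fix k x and e :: real
    assume "0 < e"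
    obtain a where a: "0 \<le> a" "\<And>vs. length vs \<le> Suc k \<Longrightarrow> norm (J x vs) \<le> a * prod_list (map norm vs)"
      using smooth_jet_bound_le[OF J] by blast
    obtain b where b: "0 \<le> b" "\<And>vs. length vs \<le> Suc k \<Longrightarrow> norm (L x vs) \<le> b * prod_list (map norm vs)"
      using smooth_jet_bound_le[OF L] by blast
    \<comment> \<open>\<open>C * d\<close> is what the three terms of \<open>leibniz_remainder\<close> add up to, relative to \<open>norm (y - x)\<close>,
      when the remainders of both factors have relative size at most \<open>d \<le> 1\<close> and \<open>norm (y - x) \<le> d\<close>.\<close>
    define C where "C = 2 ^ k * K * ((b + (1 + b)) + a * (1 + b) + a)"
    have "0 \<le> C" unfolding C_def using a b K by simp
    define d where "d = min 1 (e / (C + 1))"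
    have d: "0 < d" "d \<le> 1" "C * d \<le> e"
    proof -
      show "0 < d" "d \<le> 1" using \<open>0 < e\<close> \<open>0 \<le> C\<close> by (auto simp: d_def)
      have "C * d \<le> C * (e / (C + 1))" using \<open>0 \<le> C\<close> by (intro mult_left_mono) (auto simp: d_def)
      also have "\<dots> \<le> e" using \<open>0 < e\<close> \<open>0 \<le> C\<close> by (simp add: field_simps)
      finally show "C * d \<le> e" .
    qed
    have "\<forall>\<^sub>F y in nhds x. norm (y - x) \<le> d"
      unfolding eventually_nhds_metric dist_norm using d(1) by (intro exI[of _ d]) auto
    with smooth_jet_remainder_le[OF J d(1), of k x] smooth_jet_remainder_le[OF L d(1), of k x]
    show "\<forall>\<^sub>F y in nhds x. \<forall>vs. length vs = k \<longrightarrow>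
        norm (leibniz prod (J y) (L y) vs - leibniz prod (J x) (L x) vs
              - leibniz prod (J x) (L x) ((y - x) # vs))
          \<le> e * norm (y - x) * prod_list (map norm vs)"
    proof (eventually_elim, intro allI impI)
      fix y and vs :: "'e list"
      assume RJ: "\<forall>vs. length vs \<le> k \<longrightarrow>
          norm (J y vs - J x vs - J x ((y - x) # vs)) \<le> d * norm (y - x) * prod_list (map norm vs)"
        and RL: "\<forall>vs. length vs \<le> k \<longrightarrow>
          norm (L y vs - L x vs - L x ((y - x) # vs)) \<le> d * norm (y - x) * prod_list (map norm vs)"
        and near: "norm (y - x) \<le> d" and k: "length vs = k"
      define h where "h = norm (y - x)"
      define P where "P l = prod_list (map norm l)" for l :: "'e list"
      have P: "0 \<le> P l" for l unfolding P_def by (rule prod_list_norm_nonneg)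
      have h: "0 \<le> h" "h \<le> d" using near by (auto simp: h_def)
      have J': "norm (J x ((y - x) # l)) \<le> (a * h) * P l" if "length l \<le> k" for l
        using a(2)[of "(y - x) # l"] that by (simp add: h_def P_def mult.assoc)
      have L': "norm (L x ((y - x) # l)) \<le> (b * h) * P l" if "length l \<le> k" for l
        using b(2)[of "(y - x) # l"] that by (simp add: h_def P_def mult.assoc)
      have dL: "norm (L y l - L x l) \<le> ((1 + b) * h) * P l" if "length l \<le> k" for l
      proof -
        have "norm (L y l - L x l)
            \<le> norm (L y l - L x l - L x ((y - x) # l)) + norm (L x ((y - x) # l))"
          by (metis diff_add_cancel norm_triangle_ineq)
        also have "\<dots> \<le> d * h * P l + (b * h) * P l"
          using RL that L'[OF that] by (intro add_mono) (auto simp: h_def P_def)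
        also have "\<dots> \<le> 1 * h * P l + (b * h) * P l"
          using d h P by (intro add_mono mult_right_mono) auto
        finally show ?thesis by (simp add: algebra_simps)
      qed
      have Ly: "norm (L y l) \<le> (b + (1 + b)) * P l" if "length l \<le> k" for l
      proof -
        have "norm (L y l) \<le> norm (L x l) + norm (L y l - L x l)"
          using norm_triangle_ineq[of "L x l" "L y l - L x l"] by simp
        also have "\<dots> \<le> b * P l + ((1 + b) * h) * P l"
          using b(2)[of l] dL that by (intro add_mono) (auto simp: P_def)
        also have "\<dots> \<le> b * P l + ((1 + b) * 1) * P l"
          using h d b P by (intro add_mono mult_right_mono mult_left_mono) auto
        finally show ?thesis by (simp add: algebra_simps)
      qed
      have 1: "norm (leibniz prod (\<lambda>l. J y l - J x l - J x ((y - x) # l)) (L y) vs)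
          \<le> 2 ^ k * ((d * h) * (b + (1 + b)) * K) * P vs"
        using bd[of vs "\<lambda>l. J y l - J x l - J x ((y - x) # l)" "d * h" "L y" "b + (1 + b)"]
          RJ Ly k d h b by (simp add: P_def h_def)
      have 2: "norm (leibniz prod (\<lambda>l. J x ((y - x) # l)) (\<lambda>l. L y l - L x l) vs)
          \<le> 2 ^ k * ((a * h) * ((1 + b) * h) * K) * P vs"
        using bd[of vs "\<lambda>l. J x ((y - x) # l)" "a * h" "\<lambda>l. L y l - L x l" "(1 + b) * h"]
          J' dL k a h b by (simp add: P_def)
      have 3: "norm (leibniz prod (J x) (\<lambda>l. L y l - L x l - L x ((y - x) # l)) vs)
          \<le> 2 ^ k * (a * (d * h) * K) * P vs"
        using bd[of vs "J x" a "\<lambda>l. L y l - L x l - L x ((y - x) # l)" "d * h"]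
          RL k d h a by (simp add: P_def h_def)
      have "norm (leibniz prod (J y) (L y) vs - leibniz prod (J x) (L x) vs
              - leibniz prod (J x) (L x) ((y - x) # vs))
          \<le> 2 ^ k * ((d * h) * (b + (1 + b)) * K) * P vs
            + 2 ^ k * ((a * h) * ((1 + b) * h) * K) * P vs + 2 ^ k * (a * (d * h) * K) * P vs"
        unfolding leibniz_remainder by (intro norm_triangle_mono 1 2 3)
      also have "\<dots> \<le> 2 ^ k * ((d * h) * (b + (1 + b)) * K) * P vs
            + 2 ^ k * ((a * h) * ((1 + b) * d) * K) * P vs + 2 ^ k * (a * (d * h) * K) * P vs"
        using h a b K P d by (intro add_mono mult_right_mono mult_left_mono) auto
      also have "\<dots> = (C * d) * h * P vs" by (simp add: C_def algebra_simps)
      also have "\<dots> \<le> e * h * P vs" using d h P by (intro mult_right_mono) auto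
      finally show "norm (leibniz prod (J y) (L y) vs - leibniz prod (J x) (L x) vs
              - leibniz prod (J x) (L x) ((y - x) # vs))
          \<le> e * norm (y - x) * prod_list (map norm vs)"
        by (simp add: h_def P_def)
    qed
  qed
  then show ?thesis by (auto simp: smooth_iff_jet)
qed

lemma smooth_add:
  assumes "smooth f" "smooth g"
  shows "smooth (\<lambda>x. f x + g x)"
proof -
  from assms obtain J L where J: "smooth_jet f J" and L: "smooth_jet g L"
    by (auto simp: smooth_iff_jet)
  have "smooth_jet (\<lambda>x. f x + g x) (\<lambda>x vs. J x vs + L x vs)"
  proof (rule smooth_jetI)
    show "J x [] + L x [] = f x + g x" for x
      using J L by (simp add: smooth_jet_def)
    show "linear (\<lambda>v. J x (us @ v # ws) + L x (us @ v # ws))" for x us ws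
      by (rule linear_compose_add) (rule smooth_jetD(2)[OF J] smooth_jetD(2)[OF L])+
    show "\<exists>C. \<forall>vs. length vs = k \<longrightarrow> norm (J x vs + L x vs) \<le> C * prod_list (map norm vs)" for k x
    proof -
      obtain a where a: "\<And>vs. length vs = k \<Longrightarrow> norm (J x vs) \<le> a * prod_list (map norm vs)"
        using smooth_jetD(3)[OF J] by blast
      obtain b where b: "\<And>vs. length vs = k \<Longrightarrow> norm (L x vs) \<le> b * prod_list (map norm vs)"
        using smooth_jetD(3)[OF L] by blast
      show ?thesis
        by (rule exI[of _ "a + b"]) (use a b in \<open>auto simp: distrib_right intro: norm_triangle_mono\<close>)
    qed
    fix k x and e :: real
    assume "0 < e"
    then have "\<forall>\<^sub>F y in nhds x. \<forall>vs. length vs = k \<longrightarrow>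
        norm (J y vs - J x vs - J x ((y - x) # vs)) \<le> (e / 2) * norm (y - x) * prod_list (map norm vs)"
      and "\<forall>\<^sub>F y in nhds x. \<forall>vs. length vs = k \<longrightarrow>
        norm (L y vs - L x vs - L x ((y - x) # vs)) \<le> (e / 2) * norm (y - x) * prod_list (map norm vs)"
      by (intro smooth_jetD(4)[OF J] smooth_jetD(4)[OF L] half_gt_zero; assumption)+
    then show "\<forall>\<^sub>F y in nhds x. \<forall>vs. length vs = k \<longrightarrow>
        norm (J y vs + L y vs - (J x vs + L x vs) - (J x ((y - x) # vs) + L x ((y - x) # vs)))
          \<le> e * norm (y - x) * prod_list (map norm vs)"
    proof (eventually_elim, intro allI impI)
      fix y and vs :: "'a list"
      assume *: "\<forall>vs. length vs = k \<longrightarrow>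
          norm (J y vs - J x vs - J x ((y - x) # vs)) \<le> (e / 2) * norm (y - x) * prod_list (map norm vs)"
        "\<forall>vs. length vs = k \<longrightarrow>
          norm (L y vs - L x vs - L x ((y - x) # vs)) \<le> (e / 2) * norm (y - x) * prod_list (map norm vs)"
        "length vs = k"
      have "J y vs + L y vs - (J x vs + L x vs) - (J x ((y - x) # vs) + L x ((y - x) # vs)) =
          (J y vs - J x vs - J x ((y - x) # vs)) + (L y vs - L x vs - L x ((y - x) # vs))"
        by simp
      also have "norm \<dots> \<le> (e / 2) * norm (y - x) * prod_list (map norm vs)
          + (e / 2) * norm (y - x) * prod_list (map norm vs)"
        using * by (intro norm_triangle_mono) auto
      finally show "norm (J y vs + L y vs - (J x vs + L x vs)
            - (J x ((y - x) # vs) + L x ((y - x) # vs)))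
          \<le> e * norm (y - x) * prod_list (map norm vs)"
        by (simp add: field_simps)
    qed
  qed
  then show ?thesis by (auto simp: smooth_iff_jet)
qed

lemma smooth_const: "smooth (\<lambda>_. c)"
proof -
  have "smooth_jet (\<lambda>_::'a. c) (\<lambda>_ vs. if vs = [] then c else 0)"
    by (rule smooth_jetI)
      (auto simp: linear_iff prod_list_norm_nonneg intro!: exI[of _ "norm c"] always_eventually)
  then show ?thesis by (auto simp: smooth_iff_jet)
qed

lemma (in bounded_linear) smooth: "smooth f"
proof -
  define J where "J x vs = (case vs of [] \<Rightarrow> f x | [v] \<Rightarrow> f v | _ \<Rightarrow> 0)" for x vs
  have "smooth_jet f J"
  proof (rule smooth_jetI)
    show "J x [] = f x" for x by (simp add: J_def)
    show "linear (\<lambda>v. J x (us @ v # ws))" for x us ws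
      by (cases us; cases ws; cases "tl us") (auto simp: J_def linear_iff add scaleR)
    obtain K where K: "\<And>x. norm (f x) \<le> norm x * K" using bounded by blast
    show "\<exists>C. \<forall>vs. length vs = k \<longrightarrow> norm (J x vs) \<le> C * prod_list (map norm vs)" for k x
    proof (cases "k = 0")
      case False
      then show ?thesis
        using K by (intro exI[of _ "\<bar>K\<bar>"]) (auto simp: J_def mult.commute prod_list_norm_nonneg split: list.splits
          intro: order_trans[OF _ mult_right_mono[OF abs_ge_self]])
    qed (auto simp: J_def)
    show "\<forall>\<^sub>F y in nhds x. \<forall>vs. length vs = k \<longrightarrow>
        norm (J y vs - J x vs - J x ((y - x) # vs)) \<le> e * norm (y - x) * prod_list (map norm vs)"
      if "0 < e" for k x e
    proof (rule always_eventually, intro allI impI)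
      fix y vs
      have "J y vs - J x vs - J x ((y - x) # vs) = 0"
        by (auto simp: J_def diff split: list.splits)
      then show "norm (J y vs - J x vs - J x ((y - x) # vs))
          \<le> e * norm (y - x) * prod_list (map norm vs)"
        using that prod_list_norm_nonneg[of vs] by simp
    qed
  qed
  then show ?thesis by (auto simp: smooth_iff_jet)
qed

section \<open>A symmetric Cantor set\<close>

text \<open>
  The digits are \<open>\<plusminus>1\<close> instead of \<open>0\<close> and \<open>2\<close>. This places the Cantor set symmetrically about \<open>0\<close>
  inside \<open>[-1, 1]\<close>.
\<close>

definition cantor_point :: "(nat \<Rightarrow> real) \<Rightarrow> real" where
  "cantor_point s = (\<Sum>n. s n * (2 / 3 * (1 / 3) ^ n))"

abbreviation signs :: "(nat \<Rightarrow> real) set" where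
  "signs \<equiv> UNIV \<rightarrow> {-1, 1}"

lemma cantor_weights_sums: "(\<lambda>n. 2 / 3 * (1 / 3) ^ n) sums (1::real)"
  using sums_mult[OF geometric_sums[of "1 / 3 :: real"], of "2 / 3"] by simp

lemma abs_sign_le:
  assumes "s \<in> signs"
  shows "\<bar>s n\<bar> = (1::real)"
  using funcset_mem[OF assms, of n] by auto

lemma cantor_point_summable:
  assumes "s \<in> signs"
  shows "summable (\<lambda>n. s n * (2 / 3 * (1 / 3) ^ n))"
  by (rule summable_rabs_cancel)
    (use sums_summable[OF cantor_weights_sums] in \<open>simp add: abs_mult abs_sign_le[OF assms]\<close>)

lemma abs_cantor_point_le:
  assumes "s \<in> signs"
  shows "\<bar>cantor_point s\<bar> \<le> 1"
proof -
  have "\<bar>cantor_point s\<bar> \<le> (\<Sum>n. \<bar>s n * (2 / 3 * (1 / 3) ^ n)\<bar>)"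
    unfolding cantor_point_def
    by (rule summable_rabs)
      (use sums_summable[OF cantor_weights_sums] in \<open>simp add: abs_mult abs_sign_le[OF assms]\<close>)
  also have "\<dots> = 1"
    using sums_unique[OF cantor_weights_sums] by (simp add: abs_mult abs_sign_le[OF assms])
  finally show ?thesis .
qed

lemma cantor_point_Suc:
  assumes "s \<in> signs"
  shows "cantor_point s = (2 * s 0 + cantor_point (\<lambda>n. s (Suc n))) / 3"
proof -
  have "cantor_point s = (\<Sum>n. 1 / 3 * (s (Suc n) * (2 / 3 * (1 / 3) ^ n))) + s 0 * (2 / 3)"
    unfolding cantor_point_def
    using suminf_split_initial_segment[OF cantor_point_summable[OF assms], of 1]
    by (simp add: algebra_simps)
  also have "(\<Sum>n. 1 / 3 * (s (Suc n) * (2 / 3 * (1 / 3) ^ n))) = 1 / 3 * cantor_point (\<lambda>n. s (Suc n))"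
    unfolding cantor_point_def using assms
    by (intro suminf_mult cantor_point_summable) (auto simp: Pi_iff)
  finally show ?thesis by simp
qed

text \<open>
  The leading digit contributes \<open>\<plusminus>2/3\<close> and the tail at most \<open>1/3\<close> in absolute value. So the sign
  of the point determines the leading digit, and then the point determines its tail.
\<close>

lemma inj_on_cantor_point: "inj_on cantor_point signs"
proof
  fix s t assume "s \<in> signs" "t \<in> signs" "cantor_point s = cantor_point t"
  then have "s n = t n" for n
  proof (induction n arbitrary: s t)
    case (0 s t)
    have shift: "(\<lambda>n. s (Suc n)) \<in> signs" "(\<lambda>n. t (Suc n)) \<in> signs" using 0 by (auto simp: Pi_iff)
    have "s 0 \<in> {-1, 1}" "t 0 \<in> {-1, 1}" using 0 by (auto simp: Pi_iff)
    then show ?case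
      using 0 cantor_point_Suc[of s] cantor_point_Suc[of t] abs_cantor_point_le[OF shift(1)]
        abs_cantor_point_le[OF shift(2)] by auto
  next
    case (Suc n s t)
    have shift: "(\<lambda>n. s (Suc n)) \<in> signs" "(\<lambda>n. t (Suc n)) \<in> signs"
      using Suc.prems by (auto simp: Pi_iff)
    have "s 0 \<in> {-1, 1}" "t 0 \<in> {-1, 1}" using Suc.prems by (auto simp: Pi_iff)
    then have "cantor_point (\<lambda>n. s (Suc n)) = cantor_point (\<lambda>n. t (Suc n))"
      using Suc.prems cantor_point_Suc[of s] cantor_point_Suc[of t] abs_cantor_point_le[OF shift(1)]
        abs_cantor_point_le[OF shift(2)] by auto
    from Suc.IH[OF shift this] show ?case .
  qed
  then show "s = t" by blast
qed

text \<open>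
  Taking the closure gives closedness at once; the bounds, the symmetry and the self-similarity of the
  set of points pass to the closure.
\<close>

definition cantor_set :: "real set" where
  "cantor_set = closure (cantor_point ` signs)"

lemma uncountable_cantor_set: "uncountable cantor_set"
proof
  assume "countable cantor_set"
  then have "countable (cantor_point ` signs)"
    unfolding cantor_set_def by (meson closure_subset countable_subset)
  then have c: "countable signs"
    using countable_image_inj_on inj_on_cantor_point by blast
  define g :: "nat set \<Rightarrow> nat \<Rightarrow> real" where "g A n = (if n \<in> A then 1 else -1)" for A n
  have "inj g"
  proof
    fix A B assume "g A = g B"
    then have "A = {n. g B n = 1}" by (auto simp: g_def fun_eq_iff split: if_splits)
    also have "\<dots> = B" by (simp add: g_def)
    finally show "A = B" .
  qed
  moreover have "range g \<subseteq> signs" by (auto simp: g_def split: if_splits)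
  ultimately have "countable (UNIV :: nat set set)"
    using c countable_subset countable_image_inj_eq by metis
  then show False
    using uncountable_UNIV_real countable_eqpoll eqpoll_sym nat_sets_eqpoll_reals by metis
qed

lemma closed_cantor_set: "closed cantor_set"
  by (simp add: cantor_set_def)

lemma cantor_set_nonempty: "cantor_set \<noteq> {}"
  using uncountable_cantor_set by force

lemma cantor_set_uminus: "- t \<in> cantor_set \<longleftrightarrow> t \<in> cantor_set"
proof -
  have "uminus ` (cantor_point ` signs) = cantor_point ` signs"
  proof -
    have neg: "- cantor_point s = cantor_point (\<lambda>n. - s n)" if "s \<in> signs" for s
      using suminf_minus[OF cantor_point_summable[OF that]] by (simp add: cantor_point_def)
    have m: "(\<lambda>n. - s n) \<in> signs" if "s \<in> signs" for s using that by (auto simp: Pi_iff)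
    show ?thesis
    proof
      show "uminus ` (cantor_point ` signs) \<subseteq> cantor_point ` signs" using neg m by auto
      show "cantor_point ` signs \<subseteq> uminus ` (cantor_point ` signs)"
      proof
        fix y assume "y \<in> cantor_point ` signs"
        then obtain s where s: "s \<in> signs" "y = cantor_point s" by blast
        then have "y = - cantor_point (\<lambda>n. - s n)" using neg[OF m[OF s(1)]] by simp
        then show "y \<in> uminus ` (cantor_point ` signs)" using m[OF s(1)] by blast
      qed
    qed
  qed
  then have "uminus ` cantor_set = cantor_set"
    unfolding cantor_set_def
    using closure_scaleR[of "-1" "cantor_point ` signs"] by simp
  then show ?thesis by force
qed

lemma cantor_set_bounds: "cantor_set \<subseteq> {-1..1}"
  unfolding cantor_set_def
  by (rule closure_minimal) (use abs_cantor_point_le in \<open>auto simp: abs_le_iff\<close>)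

lemma compact_cantor_set: "compact cantor_set"
  using cantor_set_bounds closed_cantor_set
  by (meson bounded_closed_interval bounded_subset compact_eq_bounded_closed)

lemma cantor_set_subset_copies:
  "cantor_set \<subseteq> (\<lambda>t. 1 / 3 * t + 2 / 3) ` cantor_set \<union> (\<lambda>t. 1 / 3 * t + (- 2 / 3)) ` cantor_set"
    (is "_ \<subseteq> ?R")
proof -
  have "cantor_point ` signs \<subseteq> ?R"
  proof
    fix y assume "y \<in> cantor_point ` signs"
    then obtain s where s: "s \<in> signs" "y = cantor_point s" by blast
    have "cantor_point (\<lambda>n. s (Suc n)) \<in> cantor_set"
      unfolding cantor_set_def using s by (intro subsetD[OF closure_subset]) (auto simp: Pi_iff)
    moreover have "s 0 = 1 \<or> s 0 = - 1" using s by (auto simp: Pi_iff)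
    moreover have "y = 1 / 3 * cantor_point (\<lambda>n. s (Suc n)) + s 0 * (2 / 3)"
      using s cantor_point_Suc[of s] by simp
    ultimately show "y \<in> ?R" by auto
  qed
  moreover have "closed ?R"
    using compact_cantor_set
    by (intro closed_Un compact_imp_closed compact_continuous_image continuous_intros)
  ultimately have "closure (cantor_point ` signs) \<subseteq> ?R" by (rule closure_minimal)
  then show ?thesis by (simp only: cantor_set_def[symmetric])
qed

text \<open>
  The Cantor set is covered by two copies of itself scaled by \<open>1/3\<close>. Its measure \<open>m\<close> is finite and
  satisfies \<open>m \<le> 2 m / 3\<close>, hence is \<open>0\<close>.
\<close>

lemma negligible_cantor_set: "negligible cantor_set"
proof -
  let ?K = cantor_set and ?m = "measure lebesgue"
  let ?R = "\<lambda>c. (\<lambda>t. 1 / 3 * t + c) ` ?K"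
  have K: "?K \<in> lmeasurable" and R: "?R c \<in> lmeasurable" for c
    using compact_cantor_set
    by (intro lmeasurable_compact compact_continuous_image continuous_intros; assumption)+
  have m: "?m (?R c) = ?m ?K / 3" for c
    using measure_lebesgue_affine[of "1 / 3" c ?K] by simp
  have "?m ?K \<le> ?m (?R (2 / 3) \<union> ?R (- 2 / 3))"
    by (intro measure_mono_fmeasurable cantor_set_subset_copies fmeasurable.Un fmeasurableD K R)
  also have "\<dots> \<le> ?m (?R (2 / 3)) + ?m (?R (- 2 / 3))"
    by (rule measure_Un_le) (use R[THEN fmeasurableD] in blast)+
  finally have "?m ?K = 0" unfolding m using measure_nonneg[of lebesgue ?K] by linarith
  then show ?thesis using K by (simp add: negligible_iff_measure)
qed

section \<open>Coordinates and diagonal quadratic forms\<close>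

lemma infsum_eq_single:
  assumes "\<And>j. j \<noteq> i \<Longrightarrow> f j = 0"
  shows "infsum f UNIV = f i"
  using infsum_cong_neutral[of "{i}" UNIV f f] assms by auto

lift_definition ell2_unit :: "'a \<Rightarrow> 'a ell2" is "\<lambda>i j. if j = i then 1 else 0"
  by (rule finite_nonzero_values_imp_summable_on) auto

lemma inner_ell2_unit: "inner x (ell2_unit i) = ell2_nth x i"
  unfolding inner_ell2_def ell2_unit.rep_eq
  by (subst infsum_eq_single[of i]) auto

lemma bounded_linear_ell2_nth: "bounded_linear (\<lambda>x. ell2_nth x i)"
  unfolding inner_ell2_unit[symmetric] by (rule bounded_linear_inner_left)

text \<open>
  Each element of a countable dense subset has countable support, and vanishing of a coordinate is a
  closed condition.
\<close>

lemma separable_imp_countable_support: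
  fixes G :: "'a ell2 set"
  assumes "separable_space (top_of_set G)"
  obtains S where "countable S" "\<And>x i. x \<in> G \<Longrightarrow> i \<notin> S \<Longrightarrow> ell2_nth x i = 0"
proof -
  from assms obtain C where C: "countable C" "C \<subseteq> G" "top_of_set G closure_of C = G"
    by (auto simp: separable_space_def)
  define S where "S = (\<Union>c\<in>C. {i. ell2_nth c i \<noteq> 0})"
  have "countable {i. ell2_nth c i \<noteq> 0}" for c :: "'a ell2"
    using summable_countable_real[OF ell2_nth_summable[of c]] by simp
  then have "countable S" unfolding S_def using C(1) by blast
  moreover have "ell2_nth x i = 0" if "x \<in> G" "i \<notin> S" for x i
  proof -
    have "closure C \<subseteq> {x. ell2_nth x i = 0}"
    proof (rule closure_minimal)
      show "C \<subseteq> {x. ell2_nth x i = 0}" using that(2) by (auto simp: S_def)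
      show "closed {x. ell2_nth x i = 0}"
        by (intro closed_Collect_eq continuous_on_const linear_continuous_on bounded_linear_ell2_nth)
    qed
    moreover have "G \<subseteq> closure C"
      using C(2,3) by (simp add: closure_of_subtopology Int_absorb1 inf_absorb2) blast
    ultimately show ?thesis using that(1) by blast
  qed
  ultimately show ?thesis using that by blast
qed

text \<open>
  For bounded coefficients \<open>a\<close> the diagonal operator is well defined and bounded. Its purpose is to
  exhibit the quadratic form \<open>diag_form a\<close> as a bounded bilinear expression, which gives smoothness and
  the derivative.
\<close>

definition ell2_diag :: "('a \<Rightarrow> real) \<Rightarrow> 'a ell2 \<Rightarrow> 'a ell2" where
  "ell2_diag a x = Abs_ell2 (\<lambda>i. a i * ell2_nth x i)"

definition diag_form :: "('a \<Rightarrow> real) \<Rightarrow> 'a ell2 \<Rightarrow> real" where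
  "diag_form a x = (\<Sum>\<^sub>\<infinity>i. a i * (ell2_nth x i)\<^sup>2)"

context
  fixes a :: "'a \<Rightarrow> real" and C :: real
  assumes le: "\<And>i. \<bar>a i\<bar> \<le> C"
begin

lemma ell2_diag_le: "(a i * ell2_nth x i)\<^sup>2 \<le> C\<^sup>2 * (ell2_nth x i)\<^sup>2"
  unfolding power_mult_distrib using le[of i]
  by (intro mult_right_mono) (auto simp: abs_le_square_iff[symmetric])

lemma ell2_nth_diag: "ell2_nth (ell2_diag a x) i = a i * ell2_nth x i"
proof -
  have "(\<lambda>i. (a i * ell2_nth x i)\<^sup>2) summable_on UNIV"
    using summable_on_cmult_right[OF ell2_nth_summable, of "C\<^sup>2" x] ell2_diag_le
    by (rule summable_on_comparison_test) auto
  then show ?thesis unfolding ell2_diag_def by (subst Abs_ell2_inverse) auto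
qed

lemma norm_ell2_diag_le: "norm (ell2_diag a x) \<le> norm x * \<bar>C\<bar>"
proof -
  have "(\<Sum>\<^sub>\<infinity>i. (ell2_nth (ell2_diag a x) i)\<^sup>2) \<le> (\<Sum>\<^sub>\<infinity>i. C\<^sup>2 * (ell2_nth x i)\<^sup>2)"
    using summable_on_cmult_right[OF ell2_nth_summable, of "C\<^sup>2" x] ell2_diag_le
    by (intro infsum_mono ell2_nth_summable) (auto simp: ell2_nth_diag)
  also have "\<dots> = C\<^sup>2 * (\<Sum>\<^sub>\<infinity>i. (ell2_nth x i)\<^sup>2)" by (rule infsum_cmult_right')
  finally show ?thesis
    unfolding norm_ell2_eq by (metis mult.commute real_sqrt_abs real_sqrt_le_mono real_sqrt_mult)
qed

lemma bounded_linear_ell2_diag: "bounded_linear (ell2_diag a)"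
proof (rule bounded_linear_intro)
  show "ell2_diag a (x + y) = ell2_diag a x + ell2_diag a y" for x y
    by (simp add: ell2_nth_inject[symmetric] fun_eq_iff ell2_nth_diag plus_ell2.rep_eq distrib_left)
  show "ell2_diag a (r *\<^sub>R x) = r *\<^sub>R ell2_diag a x" for r x
    by (simp add: ell2_nth_inject[symmetric] fun_eq_iff ell2_nth_diag scaleR_ell2.rep_eq)
qed (rule norm_ell2_diag_le)

lemma diag_form_summable: "(\<lambda>i. a i * (ell2_nth x i)\<^sup>2) summable_on UNIV"
  using square_summable_mult[OF ell2_nth_summable[of "ell2_diag a x"] ell2_nth_summable[of x]]
  by (simp add: ell2_nth_diag power2_eq_square mult.assoc)

lemma diag_form_eq_inner: "diag_form a x = inner (ell2_diag a x) x"
  by (simp add: diag_form_def inner_ell2_def ell2_nth_diag power2_eq_square mult.assoc)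

lemma smooth_diag_form: "smooth (diag_form a)"
  unfolding diag_form_eq_inner[abs_def]
  by (intro bounded_bilinear.smooth_prod[OF bounded_bilinear_inner] bounded_linear.smooth
      bounded_linear_ell2_diag bounded_linear_ident)

lemma inner_ell2_diag_commute: "inner (ell2_diag a x) y = inner (ell2_diag a y) x"
  by (simp add: inner_ell2_def ell2_nth_diag mult_ac)

lemma diag_form_has_derivative:
  "(diag_form a has_derivative (\<lambda>h. 2 * inner (ell2_diag a x) h)) (at x)"
  unfolding diag_form_eq_inner[abs_def]
  by (rule has_derivative_eq_rhs)
    (auto intro!: derivative_eq_intros bounded_linear_imp_has_derivative bounded_linear_ell2_diag
      simp: inner_ell2_diag_commute[of _ x])

end

lemma diag_form_single:
  assumes "o' \<noteq> i" "a o' = 0"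
  shows "diag_form a (u *\<^sub>R ell2_unit o' + z *\<^sub>R ell2_unit i) = a i * z\<^sup>2"
  using assms unfolding diag_form_def
  by (subst infsum_eq_single[of i]) (auto simp: plus_ell2.rep_eq scaleR_ell2.rep_eq ell2_unit.rep_eq)

section \<open>Complex squaring\<close>

text \<open>
  The map \<open>w + i u \<mapsto> (w + i u)\<^sup>2\<close> in real coordinates.
\<close>

definition square_map :: "real \<Rightarrow> real \<Rightarrow> real ^ 2" where
  "square_map u w = (w\<^sup>2 - u\<^sup>2) *\<^sub>R axis 1 1 + (2 * u * w) *\<^sub>R axis 2 1"

lemma square_map_nth [simp]:
  "square_map u w $ 1 = w\<^sup>2 - u\<^sup>2" "square_map u w $ 2 = 2 * u * w"
  by (simp_all add: square_map_def axis_def)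

lemma square_map_uminus: "square_map (- u) (- w) = square_map u w"
  by (simp add: square_map_def)

lemma square_map_surj:
  obtains u w where "square_map u w = y"
proof -
  define z where "z = csqrt (Complex (y $ 1) (y $ 2))"
  have "z\<^sup>2 = Complex (y $ 1) (y $ 2)" by (simp add: z_def)
  then have "square_map (Im z) (Re z) = y"
    by (auto simp: vec_eq_iff forall_2 complex_eq_iff power2_eq_square)
  then show ?thesis using that by blast
qed

lemma square_map_eq_real:
  assumes "square_map u w = square_map k 0"
  shows "w = 0" "u = k \<or> u = - k"
proof -
  from assms have "w\<^sup>2 - u\<^sup>2 = - k\<^sup>2" "u * w = 0"
    by (auto simp: vec_eq_iff forall_2)
  then show "w = 0" "u = k \<or> u = - k"
    by (auto simp: power2_eq_iff) (smt (verit) zero_le_power2 power2_eq_iff zero_eq_power2)+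
qed

lemma smooth_square_map:
  assumes "smooth U" "smooth H"
  shows "smooth (\<lambda>x. square_map (U x) (H x))"
proof -
  note mult = bounded_bilinear.smooth_prod[OF bounded_bilinear_mult]
  note scale = bounded_bilinear.smooth_prod[OF bounded_bilinear_scaleR]
  have "smooth (\<lambda>x. (H x * H x + (- 1) * (U x * U x)) *\<^sub>R (axis 1 1 :: real ^ 2)
      + (2 * U x * H x) *\<^sub>R axis 2 1)"
    by (intro smooth_add mult scale smooth_const assms)
  then show ?thesis by (simp add: square_map_def power2_eq_square)
qed

text \<open>
  Away from the origin, complex squaring is a local diffeomorphism. The composite with a pair
  \<open>(U, H)\<close> is thus regular as soon as the derivative of the pair is onto, and directions \<open>e\<close> and
  \<open>d\<close> that make this derivative triangular with nonzero diagonal witness that.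
\<close>

lemma square_map_not_critical:
  assumes U: "(U has_derivative U') (at x)" and H: "(H has_derivative H') (at x)"
    and "U x \<noteq> 0 \<or> H x \<noteq> 0"
    and "U' e = 1" "U' d = 0" "H' d \<noteq> 0"
  shows "\<not> critical_point (\<lambda>x. square_map (U x) (H x)) x"
proof -
  define T where "T h = (2 * H x * H' h - 2 * U x * U' h) *\<^sub>R (axis 1 1 :: real ^ 2)
      + (2 * (U' h * H x + U x * H' h)) *\<^sub>R axis 2 1" for h
  have "((\<lambda>x. square_map (U x) (H x)) has_derivative T) (at x)"
    unfolding square_map_def T_def
    by (rule has_derivative_eq_rhs)
      (auto intro!: derivative_eq_intros U H simp: fun_eq_iff algebra_simps)
  then have T: "frechet_derivative (\<lambda>x. square_map (U x) (H x)) (at x) = T"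
    by (rule frechet_derivative_at[symmetric])
  have lin: "linear U'" "linear H'"
    using U H has_derivative_linear by blast+
  define N where "N = (U x)\<^sup>2 + (H x)\<^sup>2"
  have "N \<noteq> 0" using assms(3) by (auto simp: N_def sum_power2_eq_zero_iff)
  have "y \<in> range T" for y
  proof -
    \<comment> \<open>\<open>A\<close> and \<open>B\<close> are the prescribed derivatives of \<open>U\<close> and \<open>H\<close>: the complex number
      \<open>B + i A\<close> is \<open>y\<close> divided by \<open>2 * (H x + i U x)\<close>.\<close>
    define A where "A = (H x * y $ 2 - U x * y $ 1) / (2 * N)"
    define B where "B = (H x * y $ 1 + U x * y $ 2) / (2 * N)"
    define h where "h = A *\<^sub>R e + ((B - A * H' e) / H' d) *\<^sub>R d"
    have "U' h = A" "H' h = B"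
      using assms(4-6) lin by (simp_all add: h_def linear_add linear_cmul)
    moreover have "2 * H x * B - 2 * U x * A = y $ 1"
      using \<open>N \<noteq> 0\<close> unfolding A_def B_def
      by (simp add: divide_simps) (simp add: N_def algebra_simps power2_eq_square)
    moreover have "2 * (A * H x + U x * B) = y $ 2"
      using \<open>N \<noteq> 0\<close> unfolding A_def B_def
      by (simp add: divide_simps) (simp add: N_def algebra_simps power2_eq_square)
    ultimately have "T h = y"
      by (simp add: T_def vec_eq_iff forall_2 axis_def)
    then show ?thesis by blast
  qed
  then show ?thesis by (auto simp: critical_point_def T)
qed

section \<open>Coefficients that detect the Cantor set and its gaps\<close>

text \<open>
  As a function of \<open>u\<close> and up to a positive factor, this is the quadratic polynomial that is negative
  exactly on the open interval about \<open>t\<close> whose radius is the distance from \<open>t\<close> to the Cantor set.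
  These intervals miss the Cantor set, and those with \<open>t\<close> outside it cover its complement, whereas
  for \<open>t\<close> in the Cantor set the interval is empty and only a double zero at \<open>t\<close> remains. The same
  formula thus detects both the points of the Cantor set and the points of its gaps. The denominator
  keeps the coefficients bounded in \<open>t\<close>.
\<close>

definition gap_coeff :: "real \<Rightarrow> real \<Rightarrow> real" where
  "gap_coeff u t = ((u - t)\<^sup>2 - (infdist t cantor_set)\<^sup>2) / (1 + t\<^sup>2)"

lemma one_plus_square_pos: "0 < 1 + (t::real)\<^sup>2"
  by (simp add: add_pos_nonneg)

lemma gap_coeff_nonneg:
  assumes "u \<in> cantor_set"
  shows "0 \<le> gap_coeff u t"
proof -
  have "infdist t cantor_set \<le> \<bar>u - t\<bar>"
    using infdist_le[OF assms, of t] by (simp add: dist_real_def abs_minus_commute)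
  then have "(infdist t cantor_set)\<^sup>2 \<le> (u - t)\<^sup>2"
    using infdist_nonneg[of t cantor_set] by (metis power2_abs power_mono)
  then show ?thesis using one_plus_square_pos[of t] by (simp add: gap_coeff_def)
qed

lemma gap_coeff_cantor:
  assumes "t \<in> cantor_set"
  shows "gap_coeff u t = (u - t)\<^sup>2 / (1 + t\<^sup>2)"
  using assms by (simp add: gap_coeff_def)

lemma gap_coeff_diagonal_neg:
  assumes "u \<notin> cantor_set"
  shows "gap_coeff u u < 0"
proof -
  have "infdist u cantor_set \<noteq> 0"
    using assms in_closed_iff_infdist_zero[OF closed_cantor_set cantor_set_nonempty] by blast
  then show ?thesis using one_plus_square_pos[of u] by (simp add: gap_coeff_def divide_neg_pos)
qed

text \<open>
  Separating the powers of \<open>u\<close> writes the coefficient through three functions of \<open>t\<close> alone, all of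
  them bounded. This turns the penalty term of the construction into a polynomial in \<open>u\<close> with diagonal
  quadratic forms as coefficients.
\<close>

lemma gap_coeff_expand:
  "gap_coeff u t = u\<^sup>2 * (1 / (1 + t\<^sup>2)) + (- 2 * u) * (t / (1 + t\<^sup>2)) + gap_coeff 0 t"
  by (simp add: gap_coeff_def add_divide_distrib diff_divide_distrib power2_diff mult.assoc)

lemma gap_coeff_bounds:
  "\<bar>1 / (1 + t\<^sup>2)\<bar> \<le> 1" "\<bar>t / (1 + t\<^sup>2)\<bar> \<le> 1" "\<bar>gap_coeff 0 t\<bar> \<le> 2"
proof -
  note pos = one_plus_square_pos[of t]
  show "\<bar>1 / (1 + t\<^sup>2)\<bar> \<le> 1" using pos by (simp add: abs_mult)
  have "2 * \<bar>t\<bar> \<le> 1 + t\<^sup>2" using sum_squares_bound[of "\<bar>t\<bar>" 1] by simp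
  then show "\<bar>t / (1 + t\<^sup>2)\<bar> \<le> 1" using pos by simp
  obtain k where k: "k \<in> cantor_set" using cantor_set_nonempty by blast
  then have "\<bar>k\<bar> \<le> 1" using cantor_set_bounds by (auto simp: abs_le_iff)
  moreover have "infdist t cantor_set \<le> \<bar>t - k\<bar>"
    using infdist_le[OF k, of t] by (simp add: dist_real_def)
  ultimately have "infdist t cantor_set \<le> \<bar>t\<bar> + 1" by linarith
  then have "(infdist t cantor_set)\<^sup>2 \<le> (\<bar>t\<bar> + 1)\<^sup>2"
    by (intro power_mono infdist_nonneg)
  also have "\<dots> \<le> 2 * (1 + t\<^sup>2)"
    using \<open>2 * \<bar>t\<bar> \<le> 1 + t\<^sup>2\<close> by (simp add: power2_sum)
  finally have "(infdist t cantor_set)\<^sup>2 \<le> 2 * (1 + t\<^sup>2)" .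
  then have "(infdist t cantor_set)\<^sup>2 \<le> 2 + 2 * t\<^sup>2" by simp
  then have "\<bar>t\<^sup>2 - (infdist t cantor_set)\<^sup>2\<bar> \<le> 2 + 2 * t\<^sup>2"
    using zero_le_power2[of t] zero_le_power2[of "infdist t cantor_set"] by linarith
  then show "\<bar>gap_coeff 0 t\<bar> \<le> 2"
    using pos by (simp add: gap_coeff_def divide_le_eq)
qed

lemma gap_coeff_bounded: "\<exists>C. \<forall>t. \<bar>gap_coeff u t\<bar> \<le> C"
proof (intro exI allI)
  fix t
  have "\<bar>gap_coeff u t\<bar> \<le> \<bar>u\<^sup>2 * (1 / (1 + t\<^sup>2))\<bar> + \<bar>(- 2 * u) * (t / (1 + t\<^sup>2))\<bar> + \<bar>gap_coeff 0 t\<bar>"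
    unfolding gap_coeff_expand[of u t]
    by (intro order_trans[OF abs_triangle_ineq] add_right_mono abs_triangle_ineq)
  also have "\<dots> \<le> \<bar>u\<^sup>2\<bar> * 1 + \<bar>- 2 * u\<bar> * 1 + 2"
    unfolding abs_mult[of "u\<^sup>2"] abs_mult[of "- 2 * u"]
    by (intro add_mono mult_left_mono gap_coeff_bounds) auto
  finally show "\<bar>gap_coeff u t\<bar> \<le> \<bar>u\<^sup>2\<bar> * 1 + \<bar>- 2 * u\<bar> * 1 + 2" .
qed

section \<open>The map\<close>

text \<open>
  The index \<open>base\<close> carries the coordinate \<open>u\<close> that selects the coefficients. Every real must still
  occur as a label once \<open>base\<close> is removed.
\<close>

locale labelling =
  fixes lab :: "'g \<Rightarrow> real" and base :: 'g
  assumes lab_onto: "lab ` (- {base}) = UNIV"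
begin

definition lift_coeff :: "(real \<Rightarrow> real) \<Rightarrow> 'g \<Rightarrow> real" where
  "lift_coeff p i = (if i = base then 0 else p (lab i))"

lemma lift_coeff_le:
  assumes "\<And>t. \<bar>p t\<bar> \<le> C"
  shows "\<bar>lift_coeff p i\<bar> \<le> C"
  using assms[of "lab i"] order_trans[OF abs_ge_zero assms[of "lab i"]] by (simp add: lift_coeff_def)

lemma lift_indicator_le: "\<bar>lift_coeff (indicator cantor_set) i\<bar> \<le> 1"
  by (rule lift_coeff_le) (simp add: indicator_def)

definition mass :: "'g ell2 \<Rightarrow> real" where
  "mass = diag_form (lift_coeff (indicator cantor_set))"

definition penalty :: "real \<Rightarrow> 'g ell2 \<Rightarrow> real" where
  "penalty u = diag_form (lift_coeff (gap_coeff u))"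

definition height :: "'g ell2 \<Rightarrow> real" where
  "height x = (mass x - 1)\<^sup>2 + penalty (ell2_nth x base) x"

definition plane_map :: "'g ell2 \<Rightarrow> real ^ 2" where
  "plane_map x = square_map (ell2_nth x base) (height x)"

lemma penalty_summable: "(\<lambda>i. lift_coeff (gap_coeff u) i * (ell2_nth x i)\<^sup>2) summable_on UNIV"
proof -
  obtain C where "\<And>t. \<bar>gap_coeff u t\<bar> \<le> C" using gap_coeff_bounded by blast
  then show ?thesis by (intro diag_form_summable lift_coeff_le)
qed

lemma penalty_expand:
  "penalty u x = u\<^sup>2 * diag_form (lift_coeff (\<lambda>t. 1 / (1 + t\<^sup>2))) x
     + (- 2 * u) * diag_form (lift_coeff (\<lambda>t. t / (1 + t\<^sup>2))) x
     + diag_form (lift_coeff (gap_coeff 0)) x"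
proof -
  note s = summable_on_cmult_right[OF diag_form_summable[OF lift_coeff_le, OF gap_coeff_bounds(1),
        where x = x], of "u\<^sup>2"]
    summable_on_cmult_right[OF diag_form_summable[OF lift_coeff_le, OF gap_coeff_bounds(2),
        where x = x], of "- 2 * u"]
    diag_form_summable[OF lift_coeff_le, OF gap_coeff_bounds(3), where x = x]
  have "penalty u x = (\<Sum>\<^sub>\<infinity>i. u\<^sup>2 * (lift_coeff (\<lambda>t. 1 / (1 + t\<^sup>2)) i * (ell2_nth x i)\<^sup>2)
      + (- 2 * u) * (lift_coeff (\<lambda>t. t / (1 + t\<^sup>2)) i * (ell2_nth x i)\<^sup>2)
      + lift_coeff (gap_coeff 0) i * (ell2_nth x i)\<^sup>2)"
    unfolding penalty_def diag_form_def
    by (intro infsum_cong) (simp add: lift_coeff_def gap_coeff_expand[of u] algebra_simps)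
  also have "\<dots> = u\<^sup>2 * diag_form (lift_coeff (\<lambda>t. 1 / (1 + t\<^sup>2))) x
     + (- 2 * u) * diag_form (lift_coeff (\<lambda>t. t / (1 + t\<^sup>2))) x
     + diag_form (lift_coeff (gap_coeff 0)) x"
    unfolding diag_form_def
    by (simp only: infsum_add[OF summable_on_add[OF s(1,2)] s(3)] infsum_add[OF s(1,2)]
        infsum_cmult_right')
  finally show ?thesis .
qed

lemma smooth_height: "smooth height"
proof -
  note mult = bounded_bilinear.smooth_prod[OF bounded_bilinear_mult]
  let ?Q = "\<lambda>p. diag_form (lift_coeff p)"
  have "smooth (\<lambda>x. (mass x + (- 1)) * (mass x + (- 1))
      + (((ell2_nth x base * ell2_nth x base) * ?Q (\<lambda>t. 1 / (1 + t\<^sup>2)) x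
        + (- 2 * ell2_nth x base) * ?Q (\<lambda>t. t / (1 + t\<^sup>2)) x) + ?Q (gap_coeff 0) x))"
    unfolding mass_def
    by (intro smooth_add mult smooth_const bounded_linear.smooth[OF bounded_linear_ell2_nth]
        smooth_diag_form[OF lift_indicator_le]
        smooth_diag_form[OF lift_coeff_le, OF gap_coeff_bounds(1)]
        smooth_diag_form[OF lift_coeff_le, OF gap_coeff_bounds(2)]
        smooth_diag_form[OF lift_coeff_le, OF gap_coeff_bounds(3)])
  moreover have "height = (\<lambda>x. (mass x + (- 1)) * (mass x + (- 1))
      + (((ell2_nth x base * ell2_nth x base) * ?Q (\<lambda>t. 1 / (1 + t\<^sup>2)) x
        + (- 2 * ell2_nth x base) * ?Q (\<lambda>t. t / (1 + t\<^sup>2)) x) + ?Q (gap_coeff 0) x))"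
    by (simp add: fun_eq_iff height_def penalty_expand power2_eq_square)
  ultimately show ?thesis by simp
qed

lemma smooth_plane_map: "smooth plane_map"
  unfolding plane_map_def
  by (intro smooth_square_map smooth_height bounded_linear.smooth[OF bounded_linear_ell2_nth])

text \<open>
  The full derivative is a long expression, but along a coordinate other than \<open>base\<close> the number \<open>u\<close>
  is constant and only the two quadratic forms are differentiated.
\<close>

lemma height_has_derivative:
  obtains H' where "(height has_derivative H') (at x)"
    and "\<And>j. j \<noteq> base \<Longrightarrow> H' (ell2_unit j) =
      2 * ell2_nth x j * (2 * (mass x - 1) * indicator cantor_set (lab j)
        + gap_coeff (ell2_nth x base) (lab j))"
proof -
  let ?Q = "\<lambda>p. diag_form (lift_coeff p)" and ?D = "\<lambda>p h. 2 * inner (ell2_diag (lift_coeff p) x) h"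
  define u where "u = ell2_nth x base"
  define H' where "H' h = 2 * (mass x - 1) * ?D (indicator cantor_set) h
      + (2 * u * ell2_nth h base * ?Q (\<lambda>t. 1 / (1 + t\<^sup>2)) x + u\<^sup>2 * ?D (\<lambda>t. 1 / (1 + t\<^sup>2)) h
      + ((- 2 * ell2_nth h base) * ?Q (\<lambda>t. t / (1 + t\<^sup>2)) x + (- 2 * u) * ?D (\<lambda>t. t / (1 + t\<^sup>2)) h)
      + ?D (gap_coeff 0) h)" for h
  note d = diag_form_has_derivative[OF lift_indicator_le, where x = x]
    diag_form_has_derivative[OF lift_coeff_le, OF gap_coeff_bounds(1), where x = x]
    diag_form_has_derivative[OF lift_coeff_le, OF gap_coeff_bounds(2), where x = x]
    diag_form_has_derivative[OF lift_coeff_le, OF gap_coeff_bounds(3), where x = x]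
    bounded_linear_imp_has_derivative[OF bounded_linear_ell2_nth, of base "at x"]
  have 1: "(height has_derivative H') (at x)"
    unfolding height_def[abs_def] penalty_expand mass_def
    by (rule has_derivative_eq_rhs, (rule derivative_intros d)+)
      (simp add: fun_eq_iff H'_def u_def mass_def algebra_simps)
  have 2: "H' (ell2_unit j) = 2 * ell2_nth x j * (2 * (mass x - 1) * indicator cantor_set (lab j)
        + gap_coeff (ell2_nth x base) (lab j))" if "j \<noteq> base" for j
  proof -
    have z: "ell2_nth (ell2_unit j) base = 0" using that by (simp add: ell2_unit.rep_eq)
    have c: "lift_coeff p j = p (lab j)" for p using that by (simp add: lift_coeff_def)
    show ?thesis
      unfolding H'_def inner_ell2_unit z u_def[symmetric] gap_coeff_expand[of u "lab j"]
        ell2_nth_diag[OF lift_indicator_le]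
        ell2_nth_diag[OF lift_coeff_le, OF gap_coeff_bounds(1)]
        ell2_nth_diag[OF lift_coeff_le, OF gap_coeff_bounds(2)]
        ell2_nth_diag[OF lift_coeff_le, OF gap_coeff_bounds(3)] c
      by (simp add: algebra_simps)
  qed
  from 1 2 show ?thesis by (rule that)
qed

lemma height_single:
  assumes "i \<noteq> base" "lab i = u"
  shows "height (u *\<^sub>R ell2_unit base + z *\<^sub>R ell2_unit i) =
     (indicator cantor_set u * z\<^sup>2 - 1)\<^sup>2 + gap_coeff u u * z\<^sup>2"
proof -
  have "ell2_nth (u *\<^sub>R ell2_unit base + z *\<^sub>R ell2_unit i) base = u"
    using assms by (simp add: plus_ell2.rep_eq scaleR_ell2.rep_eq ell2_unit.rep_eq)
  then show ?thesis
    using assms unfolding height_def mass_def penalty_def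
    by (simp add: diag_form_single lift_coeff_def)
qed

text \<open>
  Every point of the plane is a square \<open>(w + i u)\<^sup>2\<close>. By the symmetry of the Cantor set, changing the
  sign of the root changes the sign of \<open>w\<close> but not whether \<open>u\<close> lies in the set. The root can be
  chosen with \<open>w \<ge> 0\<close> in the one case and \<open>w \<le> 0\<close> in the other, and such a pair is realised by a
  vector supported on \<open>base\<close> and one index labelled \<open>u\<close>.
\<close>

lemma surj_plane_map: "surj plane_map"
proof -
  have hit: "\<exists>x. ell2_nth x base = u \<and> height x = w"
    if uw: "u \<in> cantor_set \<and> 0 \<le> w \<or> u \<notin> cantor_set \<and> w \<le> 0" for u w
  proof -
    obtain i where i: "i \<noteq> base" "lab i = u" using lab_onto by (metis ComplD UNIV_I image_iff singletonI)
    obtain z where z: "(indicator cantor_set u * z\<^sup>2 - 1)\<^sup>2 + gap_coeff u u * z\<^sup>2 = w"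
    proof (cases "u \<in> cantor_set")
      case True
      then have "(indicator cantor_set u * (sqrt (1 + sqrt w))\<^sup>2 - 1)\<^sup>2
          + gap_coeff u u * (sqrt (1 + sqrt w))\<^sup>2 = w"
        using uw by (simp add: gap_coeff_cantor)
      then show ?thesis by (rule that)
    next
      case False
      then have "(indicator cantor_set u * (sqrt ((w - 1) / gap_coeff u u))\<^sup>2 - 1)\<^sup>2
          + gap_coeff u u * (sqrt ((w - 1) / gap_coeff u u))\<^sup>2 = w"
        using uw gap_coeff_diagonal_neg[OF False] by (simp add: divide_nonpos_neg)
      then show ?thesis by (rule that)
    qed
    have "ell2_nth (u *\<^sub>R ell2_unit base + z *\<^sub>R ell2_unit i) base = u"
      using i by (simp add: plus_ell2.rep_eq scaleR_ell2.rep_eq ell2_unit.rep_eq)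
    then show ?thesis using height_single[OF i, of z] z by metis
  qed
  have "\<exists>x. plane_map x = y" for y
  proof -
    obtain u w where y: "square_map u w = y" using square_map_surj .
    then have y': "square_map (- u) (- w) = y" by (simp add: square_map_uminus)
    have "(u \<in> cantor_set \<and> 0 \<le> w \<or> u \<notin> cantor_set \<and> w \<le> 0) \<or>
        (- u \<in> cantor_set \<and> 0 \<le> - w \<or> - u \<notin> cantor_set \<and> - w \<le> 0)"
      using cantor_set_uminus[of u] by auto
    then show ?thesis using hit y y' unfolding plane_map_def by metis
  qed
  then show ?thesis by (metis surj_def)
qed

text \<open>
  Over a point \<open>u\<close> of the Cantor set the height is a sum of nonnegative terms. When it vanishes,
  \<open>mass x = 1\<close> provides a nonzero coordinate with label in the Cantor set, and the vanishing of its
  penalty forces that label to be \<open>u\<close>.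
\<close>

lemma height_zero:
  assumes "height x = 0" "ell2_nth x base \<in> cantor_set"
  obtains i where "ell2_nth x i \<noteq> 0" "lab i = ell2_nth x base"
proof -
  let ?u = "ell2_nth x base"
  have nn: "0 \<le> lift_coeff (gap_coeff ?u) i * (ell2_nth x i)\<^sup>2" for i
    using gap_coeff_nonneg[OF assms(2)] by (simp add: lift_coeff_def)
  then have "0 \<le> penalty ?u x" unfolding penalty_def diag_form_def by (rule infsum_nonneg)
  then have m: "mass x = 1" and p: "penalty ?u x = 0"
    using assms(1) unfolding height_def by (auto simp: add_nonneg_eq_0_iff)
  have "\<exists>i. i \<noteq> base \<and> lab i \<in> cantor_set \<and> ell2_nth x i \<noteq> 0"
  proof (rule ccontr)
    assume "\<not> ?thesis"
    then have "lift_coeff (indicator cantor_set) i * (ell2_nth x i)\<^sup>2 = 0" for i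
      by (auto simp: lift_coeff_def indicator_def)
    then have "mass x = 0" unfolding mass_def diag_form_def by (rule infsum_0)
    then show False using m by simp
  qed
  then obtain i where i: "i \<noteq> base" "lab i \<in> cantor_set" "ell2_nth x i \<noteq> 0" by blast
  have "lift_coeff (gap_coeff ?u) i * (ell2_nth x i)\<^sup>2 = 0"
    using p unfolding penalty_def diag_form_def
    by (intro nonneg_infsum_le_0D[OF _ penalty_summable nn]) auto
  then have "gap_coeff ?u (lab i) = 0" using i by (simp add: lift_coeff_def)
  then have "lab i = ?u" using i(2) one_plus_square_pos[of "lab i"] by (simp add: gap_coeff_cantor)
  then show ?thesis using i that by blast
qed

text \<open>
  The labels seen by a separable set form a countable set, so some \<open>k\<close> in the Cantor set is, together
  with \<open>- k\<close>, not among them. The square of \<open>i k\<close> is then omitted.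
\<close>

lemma separable_image_plane_map:
  assumes "separable_space (top_of_set G)"
  shows "plane_map ` G \<noteq> UNIV"
proof -
  obtain S where S: "countable S" "\<And>x i. x \<in> G \<Longrightarrow> i \<notin> S \<Longrightarrow> ell2_nth x i = 0"
    using separable_imp_countable_support[OF assms] by blast
  have "countable (lab ` S \<union> uminus ` lab ` S)" using S(1) by simp
  then obtain k where k: "k \<in> cantor_set" "k \<notin> lab ` S \<union> uminus ` lab ` S"
    using uncountable_cantor_set by (meson countable_subset subsetI)
  have "plane_map x \<noteq> square_map k 0" if "x \<in> G" for x
  proof
    assume "plane_map x = square_map k 0"
    then have h: "height x = 0" and u: "ell2_nth x base = k \<or> ell2_nth x base = - k"
      using square_map_eq_real unfolding plane_map_def by blast+
    then have "ell2_nth x base \<in> cantor_set" using k(1) by (auto simp: cantor_set_uminus)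
    then obtain i where "ell2_nth x i \<noteq> 0" "lab i = ell2_nth x base"
      using height_zero[OF h] by blast
    then have "i \<in> S" "lab i = k \<or> lab i = - k" using S(2)[OF that] u by auto
    then show False using k(2) by force
  qed
  then show ?thesis by (metis UNIV_I imageE)
qed

text \<open>
  If all partial derivatives of the height except the one along \<open>base\<close> vanish, then each other
  nonzero coordinate has a gap coefficient equal to \<open>2 * (1 - mass x)\<close> or \<open>0\<close>, according to whether its label
  lies in the Cantor set. Summing these values makes the height a function of the mass, and a single
  nonzero coordinate with label \<open>t\<close> in the Cantor set expresses the mass by \<open>u\<close> and \<open>t\<close>.
\<close>

lemma critical_height:
  assumes "critical_point plane_map x" "plane_map x \<noteq> 0"
  shows "height x = 1 \<or> (\<exists>t\<in>cantor_set.
    height x = 1 - (1 - (ell2_nth x base - t)\<^sup>2 / (1 + t\<^sup>2) / 2)\<^sup>2)"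
proof -
  let ?u = "ell2_nth x base"
  obtain H' where H': "(height has_derivative H') (at x)"
    "\<And>j. j \<noteq> base \<Longrightarrow> H' (ell2_unit j) =
      2 * ell2_nth x j * (2 * (mass x - 1) * indicator cantor_set (lab j) + gap_coeff ?u (lab j))"
    using height_has_derivative[where x = x] by blast
  have ne: "?u \<noteq> 0 \<or> height x \<noteq> 0"
    using assms(2) by (auto simp: plane_map_def square_map_def)
  have crit: "ell2_nth x j = 0 \<or> gap_coeff ?u (lab j) = 2 * (1 - mass x) * indicator cantor_set (lab j)"
    if "j \<noteq> base" for j
  proof (rule ccontr)
    assume n: "\<not> ?thesis"
    have "2 * (mass x - 1) * indicator cantor_set (lab j) + gap_coeff ?u (lab j) \<noteq> 0"
      using n by (auto simp: algebra_simps)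
    then have d: "H' (ell2_unit j) \<noteq> 0"
      unfolding H'(2)[OF that] using n by simp
    have e: "ell2_nth (ell2_unit base) base = 1" "ell2_nth (ell2_unit j) base = 0"
      using that by (simp_all add: ell2_unit.rep_eq)
    have "\<not> critical_point (\<lambda>x. square_map (ell2_nth x base) (height x)) x"
      by (rule square_map_not_critical
          [OF bounded_linear_imp_has_derivative[OF bounded_linear_ell2_nth] H'(1) ne e d])
    then show False using assms(1) by (simp add: plane_map_def[abs_def])
  qed
  have "penalty ?u x =
      (\<Sum>\<^sub>\<infinity>i. 2 * (1 - mass x) * (lift_coeff (indicator cantor_set) i * (ell2_nth x i)\<^sup>2))"
    unfolding penalty_def diag_form_def
    by (intro infsum_cong) (use crit in \<open>auto simp: lift_coeff_def\<close>)
  also have "\<dots> = 2 * (1 - mass x) * mass x"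
    unfolding mass_def diag_form_def by (rule infsum_cmult_right')
  finally have p: "penalty ?u x = 2 * (1 - mass x) * mass x" .
  have h: "height x = 1 - (mass x)\<^sup>2"
    unfolding height_def p by (simp add: power2_eq_square algebra_simps)
  show ?thesis
  proof (cases "mass x = 0")
    case True
    then show ?thesis using h by simp
  next
    case False
    then have "\<exists>i. lift_coeff (indicator cantor_set) i * (ell2_nth x i)\<^sup>2 \<noteq> 0"
      using infsum_0[of UNIV "\<lambda>i. lift_coeff (indicator cantor_set) i * (ell2_nth x i)\<^sup>2"]
      unfolding mass_def diag_form_def by blast
    then obtain i where i: "i \<noteq> base" "lab i \<in> cantor_set" "ell2_nth x i \<noteq> 0"
      by (auto simp: lift_coeff_def indicator_def split: if_splits)
    then have e: "(?u - lab i)\<^sup>2 / (1 + (lab i)\<^sup>2) = 2 * (1 - mass x)"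
      using crit[OF i(1)] by (simp add: gap_coeff_cantor)
    have "mass x = 1 - (?u - lab i)\<^sup>2 / (1 + (lab i)\<^sup>2) / 2"
      unfolding e by (simp add: diff_divide_distrib)
    then show ?thesis using h i(2) by metis
  qed
qed

text \<open>
  By \<open>critical_height\<close> the nonzero critical values are parametrised by \<open>u\<close> alone or by \<open>u\<close> and a
  point of the Cantor set. Both parameter sets are null in the plane, and a differentiable map of the
  plane to itself preserves null sets.
\<close>

lemma negligible_critical_values: "negligible (critical_values plane_map)"
proof -
  define g where "g p = square_map (fst p) (1 - (1 - (fst p - snd p)\<^sup>2 / (1 + (snd p)\<^sup>2) / 2)\<^sup>2)"
    for p :: "real \<times> real"
  define l where "l p = square_map (fst p) 1" for p :: "real \<times> real"
  have null: "negligible ((UNIV :: real set) \<times> A)" if "negligible A" "closed A" for A :: "real set"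
  proof -
    have "A \<in> null_sets lborel"
      using that by (simp add: negligible_iff_null_sets null_sets_completion_iff)
    then have "UNIV \<times> A \<in> null_sets (lborel \<Otimes>\<^sub>M lborel)"
      by (intro lborel.times_in_null_sets2) auto
    then show ?thesis
      unfolding lborel_prod negligible_iff_null_sets by (rule null_sets_completionI)
  qed
  have dim: "DIM(real \<times> real) \<le> DIM(real ^ 2)" by simp
  have "negligible (g ` (UNIV \<times> cantor_set))"
  proof (rule negligible_differentiable_image_negligible[OF dim null])
    have ne: "1 + t\<^sup>2 \<noteq> 0" "2 + t\<^sup>2 * 2 \<noteq> 0" for t :: real
      using one_plus_square_pos[of t] by simp_all
    show "g differentiable_on UNIV \<times> cantor_set"
      unfolding g_def square_map_def differentiable_on_def
      by (intro ballI) (simp add: ne bounded_linear_imp_differentiable bounded_linear_fst bounded_linear_snd)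
  qed (rule negligible_cantor_set closed_cantor_set)+
  moreover have "negligible (l ` (UNIV \<times> {0}))"
  proof (rule negligible_differentiable_image_negligible[OF dim null])
    show "l differentiable_on UNIV \<times> {0}"
      unfolding l_def square_map_def differentiable_on_def
      by (intro ballI) (simp add: bounded_linear_imp_differentiable bounded_linear_fst)
  qed auto
  ultimately have "negligible ({0} \<union> g ` (UNIV \<times> cantor_set) \<union> l ` (UNIV \<times> {0}))" by simp
  moreover have "critical_values plane_map \<subseteq> {0} \<union> g ` (UNIV \<times> cantor_set) \<union> l ` (UNIV \<times> {0})"
  proof
    fix y assume "y \<in> critical_values plane_map"
    then obtain x where x: "plane_map x = y" "critical_point plane_map x"
      by (auto simp: critical_values_def)
    let ?u = "ell2_nth x base"
    show "y \<in> {0} \<union> g ` (UNIV \<times> cantor_set) \<union> l ` (UNIV \<times> {0})"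
    proof (cases "y = 0")
      case False
      with critical_height[OF x(2)] x(1) consider "height x = 1" |
        t where "t \<in> cantor_set" "height x = 1 - (1 - (?u - t)\<^sup>2 / (1 + t\<^sup>2) / 2)\<^sup>2"
        by blast
      then show ?thesis
      proof cases
        case 1
        then have "y = l (?u, 0)" using x(1) by (simp add: l_def plane_map_def)
        then show ?thesis by blast
      next
        case 2
        then have "y = g (?u, t)" using x(1) by (simp add: g_def plane_map_def)
        then show ?thesis using 2(1) by blast
      qed
    qed simp
  qed
  ultimately show ?thesis by (rule negligible_subset)
qed

end

section \<open>The theorem\<close>

theorem theorem8:
  assumes "(UNIV :: 'g set) \<approx> (UNIV :: nat set set)"
  shows "\<exists>f :: 'g ell2 \<Rightarrow> real ^ 2.
    smooth f \<and> surj f \<and>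
    (\<forall>G. subspace G \<and> separable_space (top_of_set G) \<longrightarrow> f ` G \<noteq> UNIV) \<and>
    critical_values f \<in> null_sets lebesgue"
proof -
  define base :: 'g where "base = undefined"
  have g: "(UNIV :: 'g set) \<approx> (UNIV :: real set)"
    using assms nat_sets_eqpoll_reals by (rule eqpoll_trans)
  have "infinite (UNIV :: 'g set)"
    using eqpoll_finite_iff[OF g] infinite_UNIV_char_0 by blast
  then have "infinite (- {base})" by (simp add: Compl_eq_Diff_UNIV)
  then have "- {base} \<approx> (UNIV :: 'g set)"
    using infinite_insert_eqpoll[of "- {base}" base]
    by (simp add: eqpoll_sym insert_Diff[of base UNIV] Compl_eq_Diff_UNIV)
  then obtain lab where "bij_betw lab (- {base}) (UNIV :: real set)"
    using g eqpoll_trans eqpoll_def by blast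
  then interpret labelling lab base
    by unfold_locales (simp add: bij_betw_def)
  show ?thesis
    using smooth_plane_map surj_plane_map separable_image_plane_map negligible_critical_values
    by (auto simp: negligible_iff_null_sets)
qed

end
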